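(* Let $q$ be a power of an odd prime, let $n\ge 4$ be even, and let $f\in\mathbb{F}_q[x_1,\dots,x_n]$ be a non-degenerate quadratic form such that $(-1)^{n/2}\det(f)$ is not a square in $\mathbb{F}_q^\times$. Let $X=V(f)\subseteq\mathbb{P}^{n-1}$. Then for every integer $P\ge1$: if $n=4$, $$\#\mathrm{Mor}_P(\mathbb{P}^1,X)(\mathbb{F}_q)=\begin{cases}\frac{q^4-1}{q^2}\,q^{2P}&\text{if }2\mid P,\\ 0&\text{if }2\nmid P,\end{cases}$$ and if $n\ge6$, $$\#\mathrm{Mor}_P(\mathbb{P}^1,X)(\mathbb{F}_q)=\frac{(q^{n/2}+1)(q^{n-2}-1)(q^{n-3}-1)}{q^{n-2}(q^{n/2-2}+1)(q-1)}\,q^{P(n-2)}+(-1)^P\frac{(q^{n-2}-1)(q^{n/2}+1)}{q^{n/2}(q^{n/2-2}+1)}\,q^{\frac n2P}.$$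
   Context: $\det(f)$ denotes the determinant of the symmetric matrix $A\in\mathbb{F}_q^{n\times n}$ with $f(\mathbf{x})=\mathbf{x}^TA\mathbf{x}$; non-degenerate means $\det(f)\neq0$. $\#\mathrm{Mor}_P(\mathbb{P}^1,X)(\mathbb{F}_q)$ denotes the number of morphisms $\mathbb{P}^1\to X$ of degree exactly $P$ defined over $\mathbb{F}_q$; equivalently, it is the number of vectors $(x_1,\dots,x_n)\in\mathbb{F}_q[t]^n$ with $\gcd(x_1,\dots,x_n)=1$, $\max_i\deg(x_i)=P$ and $f(x_1,\dots,x_n)=0$, counted modulo multiplication by scalars in $\mathbb{F}_q^\times$ (i.e. this number divided by $q-1$). *)

theory Defs
  imports "HOL-Analysis.Analysis" "HOL-Computational_Algebra.Polynomial"
begin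

definition qf_eval :: "'a::comm_ring_1 ^'n::finite ^'n \<Rightarrow> ('n \<Rightarrow> 'a poly) \<Rightarrow> 'a poly" where
  "qf_eval A x = (\<Sum>i\<in>UNIV. \<Sum>j\<in>UNIV. [:A $ i $ j:] * x i * x j)"

definition poly_family_coprime :: "('n \<Rightarrow> 'a::field poly) \<Rightarrow> bool" where
  "poly_family_coprime x \<longleftrightarrow> (\<forall>d. (\<forall>i. d dvd x i) \<longrightarrow> is_unit d)"

definition max_degree :: "('n::finite \<Rightarrow> 'a::zero poly) \<Rightarrow> nat" where
  "max_degree x = Max (range (\<lambda>i. degree (x i)))"

text \<open>#Mor_P(P^1, V(f))(F_q): primitive polynomial vectors of exact degree P with
  f(x) = 0, counted modulo scalars in F_q^*, i.e. the number divided by q - 1.\<close>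
definition num_mor :: "'a::{finite,field} ^'n::finite ^'n \<Rightarrow> nat \<Rightarrow> real" where
  "num_mor A P = real (card {x :: 'n \<Rightarrow> 'a poly. poly_family_coprime x \<and> max_degree x = P
                                 \<and> qf_eval A x = 0}) / (real CARD('a) - 1)"

end

(*
  Let M(P) be the number of all vectors of polynomials of degree at most P on which f vanishes. The
  coefficients of f(x) are 2P + 1 quadratic forms in the coefficients of x, and a linear combination of
  them with coefficients alpha is the tensor product of A with the Hankel matrix of alpha. Call s the
  number of zeros minus the number of representations of any fixed nonzero value; s is multiplicative
  in orthogonal sums, s = -q^(n/2) for A by the assumption on the determinant, and diagonalising the
  Hankel matrix gives s = q^(n(P+1)) (-q^(-n/2))^r for rank r. Averaging over alpha, q^(2P+1) M(P) is the
  sum of these values, so M(P) depends only on the rank distribution of Hankel matrices: exactly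
  q^(2e) of them have rank at most e, for e <= P. Finally every nonzero vector is a unique monic
  multiple of a primitive one, so the number of primitive zeros of exact degree P is
  M(P) - (1 + q) M(P - 1) + q M(P - 2), with M(-1) = 1.
*)
theory Submission
  imports Defs
begin

section \<open>Balanced functions\<close>

text \<open>The obstacle is the count \<open>q^(2e)\<close>: the rank of a Hankel matrix is not
  visible in the sequence \<alpha> that defines it. The way round is to keep \<alpha> and vary the
  shape. Let \<open>K(e)\<close> consist of the polynomials \<open>g\<close> of degree at most
  \<open>e\<close> such that \<alpha>, read as a linear functional, vanishes on \<open>g * h\<close>
  for all \<open>h\<close> of degree at most \<open>2P - e\<close>. For \<open>e <= P\<close> these
  kernels are trivial below the rank and gain exactly one dimension per degree from the rank on:
  multiplication by the variable forces growth, and transposition, which exchanges \<open>e\<close>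
  with \<open>2P - e\<close>, leaves no room for more. Hence \<open>|K(e)| - q |K(e-1)|\<close> is 0
  if \<open>K(e)\<close> is nontrivial and \<open>1 - q\<close> otherwise. Its sum over \<alpha> is
  found by counting pairs of \<alpha> and \<open>g\<close> with \<open>g\<close> fixed: every
  nonzero \<open>g\<close> lies in \<open>K(e)\<close> for exactly \<open>q^e\<close> choices of
  \<alpha>.\<close>

lemma CARD_field_gt_1: "CARD('a::{finite,field}) > 1"
proof -
  have "card {0, 1 :: 'a} \<le> CARD('a)" by (rule card_mono) auto
  then show ?thesis by simp
qed

text \<open>For values in a finite field, summing a nontrivial additive character of
  \<open>\<phi> x\<close> over \<open>X\<close> gives \<open>s\<close>, because the constant
  \<open>b\<close> contributes 0. So \<open>s\<close> plays the part of an exponential sum, and no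
  characters are needed.\<close>

definition balanced :: "'x set \<Rightarrow> ('x \<Rightarrow> 'a::zero) \<Rightarrow> real \<Rightarrow> bool" where
  "balanced X \<phi> s \<longleftrightarrow> finite X \<and>
     (\<exists>b. \<forall>c. real (card {x \<in> X. \<phi> x = c}) = b + (if c = 0 then s else 0))"

lemma card_fibres:
  fixes \<phi> :: "'x \<Rightarrow> 'a::finite"
  assumes "finite X"
  shows "card X = (\<Sum>c\<in>UNIV. card {x \<in> X. \<phi> x = c})"
proof -
  have "card X = (\<Sum>x\<in>X. 1)" by simp
  also have "\<dots> = (\<Sum>c\<in>UNIV. \<Sum>x\<in>{x \<in> X. \<phi> x = c}. 1)"
    using sum.group[of X UNIV \<phi> "\<lambda>_. 1::nat"] assms by simp
  finally show ?thesis by simp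
qed

text \<open>With \<open>b\<close> the common size of the nonzero fibres and \<open>q\<close> the
  size of the field, \<open>card X = q * b + s\<close>, and the zero fibre has \<open>b + s\<close>
  elements. Eliminating \<open>b\<close> leaves only \<open>card X\<close> and
  \<open>s\<close>.\<close>

lemma balanced_card_zeros:
  fixes \<phi> :: "'x \<Rightarrow> 'a::{finite,zero}"
  assumes "balanced X \<phi> s"
  shows "real CARD('a) * real (card {x \<in> X. \<phi> x = 0}) = real (card X) + (real CARD('a) - 1) * s"
proof -
  from assms obtain b where fin: "finite X"
    and b: "\<And>c. real (card {x \<in> X. \<phi> x = c}) = b + (if c = 0 then s else 0)"
    unfolding balanced_def by blast
  have "real (card X) = (\<Sum>c\<in>UNIV. real (card {x \<in> X. \<phi> x = c}))"
    by (subst card_fibres[OF fin, of \<phi>]) simp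
  also have "\<dots> = real CARD('a) * b + s"
    by (simp add: b sum.distrib)
  finally show ?thesis by (simp add: b algebra_simps)
qed

lemma balanced_reindex:
  assumes "bij_betw g X Y" and "\<And>x. x \<in> X \<Longrightarrow> \<psi> (g x) = \<phi> x"
  shows "balanced X \<phi> s \<longleftrightarrow> balanced Y \<psi> s"
proof -
  have "card {x \<in> X. \<phi> x = c} = card {y \<in> Y. \<psi> y = c}" for c
  proof (rule bij_betw_same_card[of g])
    show "bij_betw g {x \<in> X. \<phi> x = c} {y \<in> Y. \<psi> y = c}"
      using assms by (auto simp: bij_betw_def inj_on_def image_iff)
  qed
  then show ?thesis
    using bij_betw_finite[OF assms(1)] by (simp add: balanced_def)
qed

lemma balanced_zero: "finite X \<Longrightarrow> balanced X (\<lambda>_. 0) (real (card X))"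
  unfolding balanced_def by (auto intro!: exI[of _ 0])

text \<open>Scaling permutes the nonzero values and fixes 0. For this reason the square classes of
  the diagonal entries of a Hankel matrix do not matter later, only how many of them vanish.\<close>

lemma balanced_scale:
  fixes \<phi> :: "'x \<Rightarrow> 'a::field"
  assumes "balanced X \<phi> s" "k \<noteq> 0"
  shows "balanced X (\<lambda>x. k * \<phi> x) s"
proof -
  have "{x \<in> X. k * \<phi> x = c} = {x \<in> X. \<phi> x = c / k}" for c
    using assms(2) by (auto simp: field_simps)
  with assms show ?thesis by (auto simp: balanced_def)
qed

text \<open>The fibre counts convolve, and each is a constant plus a multiple of the delta function
  at 0. Convolution with a constant gives a constant, so only the product of the two deltas
  distinguishes 0.\<close>

lemma balanced_prod:
  fixes \<phi> :: "'x \<Rightarrow> 'a::{finite,ab_group_add}"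
  assumes "balanced X \<phi> s" "balanced Y \<psi> t"
  shows "balanced (X \<times> Y) (\<lambda>(x, y). \<phi> x + \<psi> y) (s * t)"
proof -
  from assms obtain b b' where fin: "finite X" "finite Y"
    and b: "\<And>c. real (card {x \<in> X. \<phi> x = c}) = b + (if c = 0 then s else 0)"
    and b': "\<And>c. real (card {y \<in> Y. \<psi> y = c}) = b' + (if c = 0 then t else 0)"
    unfolding balanced_def by blast
  have "real (card {p \<in> X \<times> Y. (case p of (x, y) \<Rightarrow> \<phi> x + \<psi> y) = c})
      = real CARD('a) * b * b' + s * b' + b * t + (if c = 0 then s * t else 0)" for c
  proof -
    let ?Z = "{p \<in> X \<times> Y. (case p of (x, y) \<Rightarrow> \<phi> x + \<psi> y) = c}"
    have "finite ?Z" using fin by auto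
    then have "real (card ?Z) = (\<Sum>u\<in>UNIV. real (card {p \<in> ?Z. \<phi> (fst p) = u}))"
      by (subst card_fibres[of ?Z "\<lambda>p. \<phi> (fst p)"]) simp_all
    also have "\<dots> = (\<Sum>u\<in>UNIV. real (card {x \<in> X. \<phi> x = u}) * real (card {y \<in> Y. \<psi> y = c - u}))"
    proof (rule sum.cong[OF refl])
      fix u
      have "{p \<in> ?Z. \<phi> (fst p) = u} = {x \<in> X. \<phi> x = u} \<times> {y \<in> Y. \<psi> y = c - u}"
        by (auto simp: algebra_simps)
      then show "real (card {p \<in> ?Z. \<phi> (fst p) = u})
          = real (card {x \<in> X. \<phi> x = u}) * real (card {y \<in> Y. \<psi> y = c - u})"
        by (simp add: card_cartesian_product)
    qed
    also have "\<dots> = (\<Sum>u\<in>UNIV. b * b' + (if u = 0 then s * (b' + (if c = 0 then t else 0)) else 0)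
        + (if u = c then b * t else 0))"
      unfolding b b' by (rule sum.cong[OF refl]) (auto simp: algebra_simps)
    also have "\<dots> = real CARD('a) * b * b' + s * b' + b * t + (if c = 0 then s * t else 0)"
      by (simp add: sum.distrib algebra_simps)
    finally show ?thesis .
  qed
  then show ?thesis unfolding balanced_def using fin by blast
qed

lemma bij_betw_PiE_insert:
  assumes "i \<notin> I"
  shows "bij_betw (\<lambda>(y, x). x(i := y)) (UNIV \<times> (I \<rightarrow>\<^sub>E UNIV)) (insert i I \<rightarrow>\<^sub>E UNIV)"
  unfolding bij_betw_def
  using inj_combinator[OF assms, of "\<lambda>_. UNIV"] PiE_insert_eq[of i I "\<lambda>_. UNIV"] by auto

lemma balanced_PiE_insert:
  fixes \<phi> :: "'i \<Rightarrow> 'w \<Rightarrow> 'a::{finite,ab_group_add}"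
  assumes "finite I" "i \<notin> I" "balanced UNIV (\<phi> i) s"
    and "balanced (I \<rightarrow>\<^sub>E UNIV) (\<lambda>x. \<Sum>j\<in>I. \<phi> j (x j)) t"
  shows "balanced (insert i I \<rightarrow>\<^sub>E UNIV) (\<lambda>x. \<Sum>j\<in>insert i I. \<phi> j (x j)) (s * t)"
proof -
  have "balanced (UNIV \<times> (I \<rightarrow>\<^sub>E UNIV)) (\<lambda>(y, x). \<phi> i y + (\<Sum>j\<in>I. \<phi> j (x j))) (s * t)"
    by (rule balanced_prod) (use assms in auto)
  then show ?thesis
  proof (subst (asm) balanced_reindex[OF bij_betw_PiE_insert[OF assms(2)]])
    fix p :: "'w \<times> ('i \<Rightarrow> 'w)" assume "p \<in> UNIV \<times> (I \<rightarrow>\<^sub>E UNIV)"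
    show "(\<Sum>j\<in>insert i I. \<phi> j ((case p of (y, x) \<Rightarrow> x(i := y)) j))
        = (case p of (y, x) \<Rightarrow> \<phi> i y + (\<Sum>j\<in>I. \<phi> j (x j)))"
      using assms(1,2) by (cases p) (auto intro!: sum.cong)
  qed
qed

lemma balanced_PiE:
  fixes \<phi> :: "'i \<Rightarrow> 'w \<Rightarrow> 'a::{finite,ab_group_add}"
  assumes "finite I" "\<And>i. i \<in> I \<Longrightarrow> balanced UNIV (\<phi> i) (s i)"
  shows "balanced (I \<rightarrow>\<^sub>E UNIV) (\<lambda>x. \<Sum>j\<in>I. \<phi> j (x j)) (\<Prod>i\<in>I. s i)"
  using assms
proof (induction I rule: finite_induct)
  case empty
  show ?case using balanced_zero[of "{} \<rightarrow>\<^sub>E UNIV"] by simp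
next
  case (insert i I)
  then have "balanced (insert i I \<rightarrow>\<^sub>E UNIV) (\<lambda>x. \<Sum>j\<in>insert i I. \<phi> j (x j)) (s i * (\<Prod>i\<in>I. s i))"
    by (intro balanced_PiE_insert) auto
  with insert show ?case by simp
qed

section \<open>Binary quadratic forms over finite fields\<close>

text \<open>On nonzero elements of a finite field of odd order this is the quadratic character; at 0
  it takes the value 1 rather than 0.\<close>

definition quad_char :: "'a::field \<Rightarrow> real" where
  "quad_char c = (if \<exists>y. y ^ 2 = c then 1 else -1)"

text \<open>Translation by 1 permutes the field, so comparing the sums of all elements before and
  after gives \<open>of_nat CARD('a) = 0\<close>. With \<open>CARD('a)\<close> odd,
  \<open>2 = 0\<close> would turn this into \<open>1 = 0\<close>.\<close>

lemma two_neq_zero_of_odd_card: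
  assumes "odd CARD('a::{finite,field})"
  shows "(2::'a) \<noteq> 0"
proof
  assume two: "(2::'a) = 0"
  have "(\<Sum>x\<in>UNIV. x) = (\<Sum>x\<in>UNIV. x + (1::'a))"
    by (rule sum.reindex_bij_betw[symmetric]) (rule bij_betw_byWitness[where f' = "\<lambda>x. x - 1"], auto)
  then have "of_nat CARD('a) = (0::'a)" by (simp add: sum.distrib)
  moreover obtain k where "CARD('a) = 2 * k + 1" using assms by (auto elim: oddE)
  ultimately show False using two by simp
qed

text \<open>The squaring map has one preimage over 0 and at most two over any other value.\<close>

lemma card_squares:
  "2 * card (range (\<lambda>y::'a::{finite,field}. y ^ 2)) \<ge> CARD('a) + 1"
proof -
  let ?S = "range (\<lambda>y::'a. y ^ 2)"
  have "CARD('a) = (\<Sum>c\<in>UNIV. card {y \<in> UNIV. y ^ 2 = (c::'a)})"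
    by (rule card_fibres) simp
  also have "\<dots> = (\<Sum>c\<in>?S. card {y \<in> UNIV. y ^ 2 = c})"
    by (rule sum.mono_neutral_right) (auto simp: card_eq_0_iff)
  also have "\<dots> = card {y \<in> UNIV. y ^ 2 = (0::'a)} + (\<Sum>c\<in>?S - {0}. card {y \<in> UNIV. y ^ 2 = c})"
    by (rule sum.remove) (auto intro!: image_eqI[of _ _ 0])
  also have "card {y \<in> UNIV. y ^ 2 = (0::'a)} = 1" by simp
  also have "(\<Sum>c\<in>?S - {0}. card {y \<in> UNIV. y ^ 2 = c}) \<le> (\<Sum>c\<in>?S - {0}. 2)"
  proof (rule sum_mono)
    fix c :: 'a assume "c \<in> ?S - {0}"
    then obtain z where "c = z ^ 2" by auto
    then have "{y \<in> UNIV. y ^ 2 = c} \<subseteq> {z, - z}" by (auto simp: power2_eq_iff)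
    then have "card {y \<in> UNIV. y ^ 2 = c} \<le> card {z, - z}" by (intro card_mono) auto
    also have "\<dots> \<le> 2" by (simp add: card_insert_if)
    finally show "card {y \<in> UNIV. y ^ 2 = c} \<le> 2" .
  qed
  also have "\<dots> = 2 * (card ?S - 1)"
  proof -
    have "0 \<in> ?S" by (auto intro!: image_eqI[of _ _ 0])
    then show ?thesis by (simp add: card_Diff_singleton)
  qed
  finally have "CARD('a) \<le> 1 + 2 * (card ?S - 1)" by simp
  moreover have "card ?S > 0" by (simp add: card_gt_0_iff)
  ultimately show ?thesis by simp
qed

text \<open>Pigeonhole: each side takes more than half of all field values.\<close>

lemma affine_squares_meet:
  fixes a b c :: "'a::{finite,field}"
  assumes "a \<noteq> 0" "b \<noteq> 0"
  shows "\<exists>x y. a * x ^ 2 = c + b * y ^ 2"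
proof -
  let ?S = "range (\<lambda>y::'a. y ^ 2)"
  let ?T = "(\<lambda>s. a * s) ` ?S" and ?U = "(\<lambda>s. c + b * s) ` ?S"
  have "card ?T = card ?S" "card ?U = card ?S"
    using assms by (auto intro!: card_image inj_onI)
  moreover have "card (?T \<union> ?U) \<le> CARD('a)" by (rule card_mono) auto
  moreover have "card ?T + card ?U = card (?T \<union> ?U) + card (?T \<inter> ?U)"
    by (rule card_Un_Int) auto
  ultimately have "?T \<inter> ?U \<noteq> {}" using card_squares[where 'a = 'a] by auto
  then show ?thesis by blast
qed

text \<open>Only the product of two nonsquares needs counting. If \<open>a\<close> is a nonsquare,
  the squares and their multiples by \<open>a\<close> meet only in 0, and by size they cover the
  field. A nonsquare \<open>b\<close> is thus \<open>a * x ^ 2\<close>, which makes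
  \<open>a * b\<close> the square of \<open>a * x\<close>.\<close>

lemma quad_char_mult:
  fixes a b :: "'a::{finite,field}"
  assumes "a \<noteq> 0" "b \<noteq> 0"
  shows "quad_char (a * b) = quad_char a * quad_char b"
proof -
  have sq_div: "\<exists>y. y ^ 2 = d" if "x ^ 2 * d = z ^ 2" "x \<noteq> 0" for x d z :: 'a
    using that by (intro exI[of _ "z / x"]) (simp add: power_divide nonzero_divide_eq_eq mult.commute)
  show ?thesis
  proof (cases "(\<exists>y. y ^ 2 = a) \<or> (\<exists>y. y ^ 2 = b)")
    case True
    have *: "quad_char (u * v) = quad_char v" if "y ^ 2 = u" "u \<noteq> 0" for u v y :: 'a
    proof -
      have "(\<exists>z. z ^ 2 = u * v) \<longleftrightarrow> (\<exists>z. z ^ 2 = v)"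
        using that sq_div[of y v] by (metis power_mult_distrib zero_power2)
      then show ?thesis by (simp add: quad_char_def)
    qed
    from True show ?thesis
    proof
      assume a: "\<exists>y. y ^ 2 = a"
      then have "quad_char (a * b) = quad_char b" using * assms by blast
      with a show ?thesis by (simp add: quad_char_def[of a])
    next
      assume b: "\<exists>y. y ^ 2 = b"
      then have "quad_char (b * a) = quad_char a" using * assms by blast
      with b show ?thesis by (simp add: quad_char_def[of b] mult.commute)
    qed
  next
    case False
    let ?S = "range (\<lambda>y::'a. y ^ 2)"
    let ?T = "(\<lambda>s. a * s) ` ?S"
    have zero: "0 \<in> ?S" "0 \<in> ?T" by (auto intro!: image_eqI[of _ _ 0])
    have "?S \<inter> ?T = {0}"
    proof
      show "?S \<inter> ?T \<subseteq> {0}"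
      proof
        fix s assume "s \<in> ?S \<inter> ?T"
        then obtain x z where s: "s = z ^ 2" "s = a * x ^ 2" by blast
        then have "x ^ 2 * a = z ^ 2" by (metis mult.commute)
        then have "x = 0" using sq_div[of x a z] False by blast
        with s show "s \<in> {0}" by simp
      qed
    qed (use zero in auto)
    moreover have "card ?T = card ?S" using assms by (auto intro!: card_image inj_onI)
    moreover have "card ?S + card ?T = card (?S \<union> ?T) + card (?S \<inter> ?T)"
      by (rule card_Un_Int) auto
    ultimately have "card (?S \<union> ?T) \<ge> CARD('a)" using card_squares[where 'a = 'a] by simp
    moreover have "card (?S \<union> ?T) \<le> CARD('a)" by (rule card_mono) auto
    ultimately have "?S \<union> ?T = UNIV" by (intro card_subset_eq) auto
    then have "b \<in> ?S \<union> ?T" by blast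
    moreover have "b \<notin> ?S" using False by blast
    ultimately have "b \<in> ?T" by blast
    then obtain x where "b = a * x ^ 2" by auto
    then have "(a * x) ^ 2 = a * b" by (simp add: power2_eq_square ac_simps)
    then have "\<exists>y. y ^ 2 = a * b" by blast
    then show ?thesis using False unfolding quad_char_def by auto
  qed
qed

text \<open>A hyperbola \<open>x * y = c\<close> with \<open>c\<close> nonzero is the graph of
  \<open>c / x\<close> and has \<open>q - 1\<close> points; the two axes have
  \<open>2 * q - 1\<close>. The difference is \<open>q\<close>.\<close>

lemma balanced_hyperbolic:
  "balanced UNIV (\<lambda>(x, y). x * y :: 'a::{finite,field}) (real CARD('a))"
proof -
  have nz: "card {p \<in> UNIV. (case p of (x, y) \<Rightarrow> x * y) = c} = CARD('a) - 1" if "c \<noteq> 0" for c :: 'a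
  proof -
    have "bij_betw (\<lambda>x. (x, c / x)) (UNIV - {0}) {p \<in> UNIV. (case p of (x, y) \<Rightarrow> x * y) = c}"
      by (rule bij_betw_byWitness[where f' = fst]) (use that in \<open>auto simp: field_simps\<close>)
    from bij_betw_same_card[OF this] show ?thesis by (simp add: card_Diff_singleton)
  qed
  have "{p \<in> UNIV. (case p of (x, y) \<Rightarrow> x * y) = (0::'a)} = {0} \<times> UNIV \<union> (UNIV - {0}) \<times> {0}"
    by auto
  then have "card {p \<in> UNIV. (case p of (x, y) \<Rightarrow> x * y) = (0::'a)} = CARD('a) + (CARD('a) - 1)"
    by (simp only:) (subst card_Un_disjoint, auto simp: card_cartesian_product card_Diff_singleton)
  moreover have ge: "CARD('a) \<ge> 1" by (simp add: Suc_leI)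
  ultimately have "card {p \<in> UNIV. (case p of (x, y) \<Rightarrow> x * y) = (0::'a)} + 1 = 2 * CARD('a)" by linarith
  then have "real (card {p \<in> UNIV. (case p of (x, y) \<Rightarrow> x * y) = (0::'a)}) = 2 * real CARD('a) - 1"
    by linarith
  then show ?thesis unfolding balanced_def using nz ge
    by (auto intro!: exI[of _ "real (CARD('a) - 1)"] simp: of_nat_diff)
qed

text \<open>The norm form \<open>x\<^sup>2 - d y\<^sup>2\<close> is multiplicative, so all its nonzero fibres have the size of the
  fibre over 1.\<close>
lemma balanced_norm_form:
  fixes d :: "'a::{finite,field}"
  assumes "\<nexists>y. y ^ 2 = d"
  shows "balanced UNIV (\<lambda>(x, y). x ^ 2 - d * y ^ 2) (- real CARD('a))"
proof -
  define N where "N = (\<lambda>(x, y). x ^ 2 - d * y ^ 2)"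
  define F where "F c = {p \<in> UNIV. N p = c}" for c
  have d: "d \<noteq> 0" using assms by (metis zero_power2)
  have N0: "p = (0, 0)" if "N p = 0" for p
  proof (cases p)
    case (Pair x y)
    have "y = 0"
    proof (rule ccontr)
      assume "y \<noteq> 0"
      with that Pair have "(x / y) ^ 2 = d" by (simp add: N_def power_divide)
      with assms show False by blast
    qed
    with that Pair show ?thesis by (simp add: N_def)
  qed
  then have F0: "F 0 = {(0, 0)}" by (auto simp: F_def N_def)
  have F1: "card (F c) = card (F 1)" if c: "c \<noteq> 0" for c
  proof -
    from affine_squares_meet[of 1 d c] d obtain u v where "u ^ 2 = c + d * v ^ 2" by auto
    then have uv: "u ^ 2 - d * v ^ 2 = c" by simp
    \<comment> \<open>This is multiplication by \<open>u + v * sqrt d\<close>, an element of norm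
      \<open>c\<close>, in the quadratic extension by \<open>sqrt d\<close>. The inverse multiplies
      by the conjugate and divides by \<open>c\<close>.\<close>
    have "bij_betw (\<lambda>(x, y). (u * x + d * v * y, u * y + v * x)) (F 1) (F c)"
    proof (rule bij_betw_byWitness[where f' = "\<lambda>(x, y). ((u * x - d * v * y) / c, (u * y - v * x) / c)"])
      show "\<forall>p\<in>F 1. (case case p of (x, y) \<Rightarrow> (u * x + d * v * y, u * y + v * x) of
          (x, y) \<Rightarrow> ((u * x - d * v * y) / c, (u * y - v * x) / c)) = p"
      proof
        fix p
        obtain x y :: 'a where p: "p = (x, y)" by fastforce
        have "u * (u * x + d * v * y) - d * v * (u * y + v * x) = x * (u ^ 2 - d * v ^ 2)"
          "u * (u * y + v * x) - v * (u * x + d * v * y) = y * (u ^ 2 - d * v ^ 2)"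
          by (simp_all add: algebra_simps power2_eq_square)
        then show "(case case p of (x, y) \<Rightarrow> (u * x + d * v * y, u * y + v * x) of
          (x, y) \<Rightarrow> ((u * x - d * v * y) / c, (u * y - v * x) / c)) = p"
          using c by (simp only: p uv prod.case) simp
      qed
      show "\<forall>p\<in>F c. (case case p of (x, y) \<Rightarrow> ((u * x - d * v * y) / c, (u * y - v * x) / c) of
          (x, y) \<Rightarrow> (u * x + d * v * y, u * y + v * x)) = p"
      proof
        fix p
        obtain x y :: 'a where p: "p = (x, y)" by fastforce
        have "u * (u * x - d * v * y) + d * v * (u * y - v * x) = x * (u ^ 2 - d * v ^ 2)"
          "u * (u * y - v * x) + v * (u * x - d * v * y) = y * (u ^ 2 - d * v ^ 2)"
          by (simp_all add: algebra_simps power2_eq_square)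
        then show "(case case p of (x, y) \<Rightarrow> ((u * x - d * v * y) / c, (u * y - v * x) / c) of
          (x, y) \<Rightarrow> (u * x + d * v * y, u * y + v * x)) = p"
          using c by (simp only: p prod.case times_divide_eq_right add_divide_distrib[symmetric] uv) simp
      qed
      have id1: "(u * x + d * v * y) ^ 2 - d * (u * y + v * x) ^ 2
          = (u ^ 2 - d * v ^ 2) * (x ^ 2 - d * y ^ 2)" for x y
        by (simp add: algebra_simps power2_eq_square)
      have id2: "(u * x - d * v * y) ^ 2 - d * (u * y - v * x) ^ 2
          = (u ^ 2 - d * v ^ 2) * (x ^ 2 - d * y ^ 2)" for x y
        by (simp add: algebra_simps power2_eq_square)
      show "(\<lambda>(x, y). (u * x + d * v * y, u * y + v * x)) ` F 1 \<subseteq> F c"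
        by (auto simp: F_def N_def id1 uv)
      have "((u * x - d * v * y) / c) ^ 2 - d * ((u * y - v * x) / c) ^ 2 = (x ^ 2 - d * y ^ 2) / c" for x y
      proof -
        have "((u * x - d * v * y) / c) ^ 2 - d * ((u * y - v * x) / c) ^ 2
            = ((u * x - d * v * y) ^ 2 - d * (u * y - v * x) ^ 2) / c ^ 2"
          by (simp only: power_divide diff_divide_distrib[symmetric] times_divide_eq_right)
        then show ?thesis unfolding id2 uv using c by (simp add: power2_eq_square)
      qed
      then show "(\<lambda>(x, y). ((u * x - d * v * y) / c, (u * y - v * x) / c)) ` F c \<subseteq> F 1"
        using c by (auto simp: F_def N_def)
    qed
    from bij_betw_same_card[OF this] show ?thesis by simp
  qed
  \<comment> \<open>The \<open>q^2 - 1\<close> nonzero pairs are shared equally by the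
    \<open>q - 1\<close> nonzero norms, so each norm occurs \<open>q + 1\<close> times, while 0
    occurs once. The difference is \<open>-q\<close>.\<close>
  have "CARD('a \<times> 'a) = (\<Sum>c\<in>UNIV. card (F c))"
    unfolding F_def by (rule card_fibres) simp
  also have "\<dots> = card (F 0) + (\<Sum>c\<in>UNIV - {0}. card (F c))"
    by (rule sum.remove) auto
  also have "(\<Sum>c\<in>UNIV - {0}. card (F c)) = (\<Sum>c\<in>UNIV - {0::'a}. card (F 1))"
    by (rule sum.cong) (auto intro: F1)
  also have "\<dots> = (CARD('a) - 1) * card (F 1)" by (simp add: card_Diff_singleton)
  finally have "CARD('a) * CARD('a) = 1 + (CARD('a) - 1) * card (F 1)" by (simp add: F0)
  then have "real (CARD('a) * CARD('a)) = real (1 + (CARD('a) - 1) * card (F 1))" by simp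
  then have "(real CARD('a) - 1) * (real CARD('a) + 1) = (real CARD('a) - 1) * real (card (F 1))"
    by (simp add: algebra_simps of_nat_diff Suc_leI)
  moreover have "real CARD('a) \<noteq> 1"
    using CARD_field_gt_1[where 'a = 'a] by simp
  ultimately have "real (card (F 1)) = real CARD('a) + 1" by simp
  then have "real (card (F c)) = real CARD('a) + 1 + (if c = 0 then - real CARD('a) else 0)" for c
    using F0 F1[of c] by simp
  then have "balanced UNIV N (- real CARD('a))"
    unfolding balanced_def F_def by (intro conjI exI allI) simp_all
  then show ?thesis by (simp add: N_def)
qed

text \<open>Multiplied by \<open>a\<close>, the form becomes \<open>(a * x) ^ 2 - d * y ^ 2\<close>
  with \<open>d = - (a * b)\<close>. If \<open>d = z ^ 2\<close> it is the product of
  \<open>a * x + z * y\<close> and \<open>a * x - z * y\<close>, which are independent as 2 is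
  invertible; otherwise it is a norm form.\<close>

lemma balanced_binary:
  fixes a b :: "'a::{finite,field}"
  assumes odd: "odd CARD('a)" and "a \<noteq> 0" "b \<noteq> 0"
  shows "balanced UNIV (\<lambda>(x, y). a * x ^ 2 + b * y ^ 2) (quad_char (- (a * b)) * real CARD('a))"
proof -
  have two: "(2::'a) \<noteq> 0" using odd by (rule two_neq_zero_of_odd_card)
  have "balanced UNIV (\<lambda>(x, y). (a * x) ^ 2 - - (a * b) * y ^ 2) (quad_char (- (a * b)) * real CARD('a))"
  proof (cases "\<exists>z. z ^ 2 = - (a * b)")
    case True
    then obtain z where z: "z ^ 2 = - (a * b)" by blast
    then have "z \<noteq> 0" using assms by auto
    have "inj (\<lambda>(x, y). (a * x + z * y, a * x - z * y))"
    proof (rule injI, clarify)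
      fix x y x' y' assume e: "a * x + z * y = a * x' + z * y'" "a * x - z * y = a * x' - z * y'"
      have "2 * (a * x) = (a * x + z * y) + (a * x - z * y)" by simp
      also have "\<dots> = 2 * (a * x')" unfolding e by simp
      finally have "x = x'" using two assms(2) by simp
      with e(1) \<open>z \<noteq> 0\<close> show "x = x' \<and> y = y'" by simp
    qed
    moreover from this have "surj (\<lambda>(x, y). (a * x + z * y, a * x - z * y))"
      by (rule finite_UNIV_inj_surj[OF finite])
    ultimately have "bij_betw (\<lambda>(x, y). (a * x + z * y, a * x - z * y)) UNIV (UNIV :: ('a \<times> 'a) set)"
      by (rule bijI)
    moreover have "(a * x + z * y) * (a * x - z * y) = (a * x) ^ 2 - - (a * b) * y ^ 2" for x y
      unfolding z[symmetric] by (simp add: algebra_simps power2_eq_square)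
    ultimately have "balanced UNIV (\<lambda>(x, y). (a * x) ^ 2 - - (a * b) * y ^ 2) (real CARD('a))"
      by (subst balanced_reindex[where Y = UNIV and \<psi> = "\<lambda>(x, y). x * y"])
        (use balanced_hyperbolic in auto)
    with True show ?thesis by (simp add: quad_char_def)
  next
    case False
    have "bij_betw (\<lambda>(x, y). (a * x, y)) UNIV (UNIV :: ('a \<times> 'a) set)"
      by (rule bij_betw_byWitness[where f' = "\<lambda>(u, v). (u / a, v)"]) (use assms in auto)
    then have "balanced UNIV (\<lambda>(x, y). (a * x) ^ 2 - - (a * b) * y ^ 2) (- real CARD('a))"
      by (subst balanced_reindex[where Y = UNIV and \<psi> = "\<lambda>(x, y). x ^ 2 - - (a * b) * y ^ 2"])
        (use balanced_norm_form[OF False] in auto)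
    with False show ?thesis by (simp add: quad_char_def)
  qed
  from balanced_scale[OF this, of "1 / a"] assms(2)
  have "balanced UNIV (\<lambda>p. 1 / a * (case p of (x, y) \<Rightarrow> (a * x) ^ 2 - - (a * b) * y ^ 2))
      (quad_char (- (a * b)) * real CARD('a))" by simp
  moreover have "(\<lambda>p. 1 / a * (case p of (x, y) \<Rightarrow> (a * x) ^ 2 - - (a * b) * y ^ 2))
      = (\<lambda>(x, y). a * x ^ 2 + b * y ^ 2)"
    using assms(2) by (auto simp: fun_eq_iff field_simps power2_eq_square)
  ultimately show ?thesis by simp
qed

section \<open>Diagonalisation by shears\<close>

text \<open>The congruent matrix \<open>E^T M E\<close>, where \<open>E\<close> is the identity with
  \<open>c\<close> added to row \<open>i\<close>: it belongs to the substitution of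
  \<open>x i + (\<Sum>j. c j * x j)\<close> for \<open>x i\<close>. Functions of two indices serve
  both for indices in a finite type and for the index set \<open>{..P}\<close>.\<close>

definition shear :: "('i \<Rightarrow> 'i \<Rightarrow> 'a::comm_ring_1) \<Rightarrow> 'i \<Rightarrow> ('i \<Rightarrow> 'a) \<Rightarrow> 'i \<Rightarrow> 'i \<Rightarrow> 'a" where
  "shear M i c = (\<lambda>j k. M j k + c j * M i k + M j i * c k + c j * M i i * c k)"

lemma shear_sym:
  "(\<And>j k. M j k = M k j) \<Longrightarrow> shear M i c j k = shear M i c k j"
  by (simp add: shear_def algebra_simps)

text \<open>Gaussian elimination by congruences. A pivot on the diagonal can be created by a shear because
  \<open>2\<close> is invertible.\<close>
lemma symmetric_shear_induct [consumes 3, case_names diagonal shear]: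
  fixes M :: "'i \<Rightarrow> 'i \<Rightarrow> 'a::field"
  assumes fin: "finite I" and two: "(2::'a) \<noteq> 0" and sym: "\<And>j k. M j k = M k j"
    and diag: "\<And>M. (\<And>j k. M j k = M k j) \<Longrightarrow>
      (\<And>j k. j \<in> I \<Longrightarrow> k \<in> I \<Longrightarrow> j \<noteq> k \<Longrightarrow> M j k = 0) \<Longrightarrow> R M"
    and step: "\<And>M i c. (\<And>j k. M j k = M k j) \<Longrightarrow> i \<in> I \<Longrightarrow> c i = 0 \<Longrightarrow>
      R (shear M i c) \<Longrightarrow> R M"
  shows "R M"
proof -
  \<comment> \<open>\<open>K\<close> is the block still to be cleared: rows outside \<open>K\<close>
    are already zero off the diagonal.\<close>
  have "R M" if "finite K" "K \<subseteq> I" "\<And>j k. M j k = M k j"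
    "\<And>j k. j \<in> I \<Longrightarrow> k \<in> I \<Longrightarrow> j \<noteq> k \<Longrightarrow> j \<notin> K \<Longrightarrow> M j k = 0" for K M
    using that
  proof (induction "card K" arbitrary: K M rule: less_induct)
    case less
    note symM = less.prems(3) and out = less.prems(4)
    have out': "M j k = 0" if "j \<in> I" "k \<in> I" "j \<noteq> k" "k \<notin> K" for j k
      using out[of k j] symM[of j k] that by auto
    have pivot: "R N"
      if symN: "\<And>j k. N j k = N k j"
        and outN: "\<And>j k. j \<in> I \<Longrightarrow> k \<in> I \<Longrightarrow> j \<noteq> k \<Longrightarrow> j \<notin> K \<Longrightarrow> N j k = 0"
        and i: "i \<in> K" "N i i \<noteq> 0" for N i
    proof -
      \<comment> \<open>This choice cancels row \<open>i\<close> of the sheared matrix off the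
        diagonal, so \<open>i\<close> can leave the block.\<close>
      define c where "c j = (if j = i then 0 else - N i j / N i i)" for j
      have "R (shear N i c)"
      proof (rule less.hyps[of "K - {i}"])
        show "card (K - {i}) < card K"
          using i less.prems(1) by (intro card_Diff1_less)
        show "shear N i c j k = shear N i c k j" for j k
          using symN by (rule shear_sym)
        show "shear N i c j k = 0" if jk: "j \<in> I" "k \<in> I" "j \<noteq> k" "j \<notin> K - {i}" for j k
        proof (cases "j = i")
          case True
          then show ?thesis using jk i by (simp add: shear_def c_def)
        next
          case False
          then have "j \<notin> K" using jk by simp
          have "N j i = 0" using outN[of j i] False i \<open>j \<notin> K\<close> jk less.prems(2) by auto
          moreover have "N i j = 0" using symN[of i j] calculation by simp
          moreover have "N j k = 0" using outN jk \<open>j \<notin> K\<close> by auto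
          ultimately show ?thesis by (simp add: shear_def c_def)
        qed
      qed (use less.prems in auto)
      then show ?thesis
        using step[of N i c] symN i less.prems(2) by (auto simp: c_def)
    qed
    consider (diag) "\<forall>j\<in>K. \<forall>k\<in>K. j \<noteq> k \<longrightarrow> M j k = 0" | (piv) i where "i \<in> K" "M i i \<noteq> 0"
      | (off) i j where "i \<in> K" "j \<in> K" "i \<noteq> j" "M i j \<noteq> 0" "\<forall>k\<in>K. M k k = 0"
      by blast
    then show ?case
    proof cases
      case diag
      have "M j k = 0" if "j \<in> I" "k \<in> I" "j \<noteq> k" for j k
        using diag out[of j k] out'[of j k] that by blast
      then show ?thesis using assms(4)[of M] symM by blast
    next
      case piv
      with symM out show ?thesis by (intro pivot[of M i]) auto
    next
      case off
      \<comment> \<open>Adding \<open>x j\<close> to \<open>x i\<close> turns the diagonal entry at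
        \<open>j\<close> into \<open>2 * M i j\<close>, because \<open>M i i\<close> and
        \<open>M j j\<close> vanish. The block does not shrink here; it shrinks when
        \<open>j\<close> is then used as pivot.\<close>
      define c where "c k = (if k = j then 1 else 0 :: 'a)" for k
      have "R (shear M i c)"
      proof (rule pivot[of _ j])
        show "shear M i c j k = shear M i c k j" for j k
          using symM by (rule shear_sym)
        show "shear M i c l k = 0" if lk: "l \<in> I" "k \<in> I" "l \<noteq> k" "l \<notin> K" for l k
        proof -
          have "c l = 0" using off lk by (auto simp: c_def)
          moreover have "M l k = 0" "M l i = 0" using out[of l k] out[of l i] lk off less.prems(2) by auto
          ultimately show ?thesis by (simp add: shear_def)
        qed
        show "j \<in> K" by fact
        have "shear M i c j j = 2 * M i j" using off symM[of j i] by (simp add: shear_def c_def)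
        then show "shear M i c j j \<noteq> 0" using two off by simp
      qed
      then show ?thesis using step[of M i c] symM off less.prems(2) by (auto simp: c_def)
    qed
  qed
  from this[of I M] fin sym show ?thesis by blast
qed

section \<open>Tensor products of a symmetric matrix with a bilinear form\<close>

locale scaled_form =
  fixes sm :: "'a::{finite,field} \<Rightarrow> 'w::{finite,ab_group_add} \<Rightarrow> 'w" and b :: "'w \<Rightarrow> 'w \<Rightarrow> 'a"
  assumes b_add_left: "b (x + y) z = b x z + b y z"
    and b_add_right: "b x (y + z) = b x y + b x z"
    and b_scale_left: "b (sm c x) y = c * b x y"
    and b_scale_right: "b x (sm c y) = c * b x y"
begin

lemma b_zero: "b 0 x = 0" "b x 0 = 0"
  using b_add_left[of 0 0 x] b_add_right[of x 0 0] by (simp_all only: add_0 add_cancel_right_right)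

lemma b_sum_left: "b (\<Sum>i\<in>I. x i) y = (\<Sum>i\<in>I. b (x i) y)"
  by (induction I rule: infinite_finite_induct) (simp_all add: b_zero b_add_left)

lemma b_sum_right: "b y (\<Sum>i\<in>I. x i) = (\<Sum>i\<in>I. b y (x i))"
  by (induction I rule: infinite_finite_induct) (simp_all add: b_zero b_add_right)

text \<open>The quadratic form of the tensor product of \<open>M\<close> with \<open>b\<close>. It
  is used twice: with multiplication of field elements as \<open>b\<close>, to treat a symmetric
  matrix alone, and with \<open>bil A\<close> as \<open>b\<close>, to treat a Hankel matrix tensored
  with \<open>A\<close>.\<close>

definition mform :: "'i set \<Rightarrow> ('i \<Rightarrow> 'i \<Rightarrow> 'a) \<Rightarrow> ('i \<Rightarrow> 'w) \<Rightarrow> 'a" where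
  "mform I M x = (\<Sum>j\<in>I. \<Sum>k\<in>I. M j k * b (x j) (x k))"

lemma mform_diagonal:
  assumes "finite I" "\<And>j k. j \<in> I \<Longrightarrow> k \<in> I \<Longrightarrow> j \<noteq> k \<Longrightarrow> M j k = 0"
  shows "mform I M x = (\<Sum>j\<in>I. M j j * b (x j) (x j))"
  unfolding mform_def
proof (rule sum.cong[OF refl])
  fix j assume j: "j \<in> I"
  have "(\<Sum>k\<in>I. M j k * b (x j) (x k)) = (\<Sum>k\<in>I. if k = j then M j j * b (x j) (x j) else 0)"
    by (rule sum.cong) (use assms(2) j in auto)
  then show "(\<Sum>k\<in>I. M j k * b (x j) (x k)) = M j j * b (x j) (x j)"
    using assms(1) j by simp
qed

text \<open>By bilinearity the substitution gives four double sums, as each argument contributes its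
  old value or the added sum. They match the four summands of \<open>shear\<close>.\<close>

lemma mform_shear:
  assumes fin: "finite I" and i: "i \<in> I"
  shows "mform I M (x(i := x i + (\<Sum>j\<in>I. sm (c j) (x j)))) = mform I (shear M i c) x"
proof -
  define y where "y = (\<Sum>j\<in>I. sm (c j) (x j))"
  define x' where "x' = x(i := x i + y)"
  have bl: "b (x' j) z = b (x j) z + (if j = i then b y z else 0)" for j z
    by (simp add: x'_def b_add_left)
  have br: "b z (x' j) = b z (x j) + (if j = i then b z y else 0)" for j z
    by (simp add: x'_def b_add_right)
  have "mform I M x' = (\<Sum>j\<in>I. \<Sum>k\<in>I. M j k * b (x j) (x k)
      + (if j = i then M i k * b y (x k) else 0)
      + (if k = i then M j i * b (x j) y else 0)
      + (if k = i then if j = i then M i i * b y y else 0 else 0))"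
    unfolding mform_def by (intro sum.cong refl) (simp add: bl br algebra_simps)
  also have "\<dots> = mform I M x + (\<Sum>k\<in>I. M i k * b y (x k)) + (\<Sum>j\<in>I. M j i * b (x j) y)
      + M i i * b y y"
  proof -
    have "(\<Sum>j\<in>I. \<Sum>k\<in>I. if j = i then M i k * b y (x k) else 0) = (\<Sum>k\<in>I. M i k * b y (x k))"
      by (subst sum.swap) (simp add: fin i)
    then show ?thesis by (simp add: mform_def sum.distrib fin i)
  qed
  also have "(\<Sum>k\<in>I. M i k * b y (x k)) = (\<Sum>j\<in>I. \<Sum>k\<in>I. c j * M i k * b (x j) (x k))"
    by (subst sum.swap) (simp add: y_def b_sum_left b_scale_left sum_distrib_left ac_simps)
  also have "(\<Sum>j\<in>I. M j i * b (x j) y) = (\<Sum>j\<in>I. \<Sum>k\<in>I. M j i * c k * b (x j) (x k))"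
    by (simp add: y_def b_sum_right b_scale_right sum_distrib_left ac_simps)
  also have "M i i * b y y = (\<Sum>j\<in>I. \<Sum>k\<in>I. c j * M i i * c k * b (x j) (x k))"
    by (subst sum.swap) (simp add: y_def b_sum_left b_sum_right b_scale_left b_scale_right sum_distrib_left ac_simps)
  finally show ?thesis
    by (simp add: x'_def y_def mform_def shear_def sum.distrib[symmetric] algebra_simps)
qed

end

text \<open>Since \<open>c i = 0\<close>, the added sum does not involve \<open>x i\<close>, so
  subtracting the same sum inverts the map.\<close>

lemma bij_betw_shear:
  fixes sm :: "'a::zero \<Rightarrow> 'w::ab_group_add \<Rightarrow> 'w"
  assumes "finite I" "i \<in> I" "c i = 0" "\<And>w. sm 0 w = 0"
  shows "bij_betw (\<lambda>x. x(i := x i + (\<Sum>j\<in>I. sm (c j) (x j)))) (I \<rightarrow>\<^sub>E UNIV) (I \<rightarrow>\<^sub>E UNIV)"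
proof -
  have inv: "(\<Sum>j\<in>I. sm (c j) ((x(i := z)) j)) = (\<Sum>j\<in>I. sm (c j) (x j))" for x z
    by (rule sum.cong) (use assms in auto)
  show ?thesis
    by (rule bij_betw_byWitness[where f' = "\<lambda>x. x(i := x i - (\<Sum>j\<in>I. sm (c j) (x j)))"])
      (use assms inv in \<open>auto simp: PiE_iff extensional_def\<close>)
qed

text \<open>The variables are split off in pairs. Each pair contributes the character of minus the
  product of its two coefficients, and these signs accumulate to
  \<open>(-1) ^ (card I div 2)\<close>.\<close>

lemma balanced_sum_squares:
  fixes d :: "'i \<Rightarrow> 'a::{finite,field}"
  assumes odd: "odd CARD('a)" and "finite I" "even (card I)" "\<And>i. i \<in> I \<Longrightarrow> d i \<noteq> 0"
  shows "balanced (I \<rightarrow>\<^sub>E UNIV) (\<lambda>x. \<Sum>i\<in>I. d i * (x i * x i))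
    (quad_char ((-1) ^ (card I div 2) * (\<Prod>i\<in>I. d i)) * real CARD('a) ^ (card I div 2))"
  using assms(2-)
proof (induction "card I" arbitrary: I rule: less_induct)
  case less
  show ?case
  proof (cases "card I = 0")
    case True
    then have "I = {}" using less.prems by simp
    moreover have "\<exists>y::'a. y ^ 2 = 1" by (rule exI[of _ 1]) simp
    ultimately show ?thesis
      using balanced_zero[of "{} \<rightarrow>\<^sub>E (UNIV :: 'a set)"] by (simp add: quad_char_def)
  next
    case False
    then obtain i I' where i: "I = insert i I'" "i \<notin> I'" by (metis card_eq_0_iff ex_in_conv mk_disjoint_insert)
    then have "card I = Suc (card I')" "finite I'" using less.prems by auto
    then have "I' \<noteq> {}" using less.prems by auto
    then obtain j J where j: "I' = insert j J" "j \<notin> J" by (metis ex_in_conv mk_disjoint_insert)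
    have J: "finite J" "card I = Suc (Suc (card J))" "i \<noteq> j" "i \<notin> J"
      using i j less.prems by auto
    have IJ: "I = insert i (insert j J)" using i j by simp
    have IH: "balanced (J \<rightarrow>\<^sub>E UNIV) (\<lambda>x. \<Sum>i\<in>J. d i * (x i * x i))
        (quad_char ((-1) ^ (card J div 2) * (\<Prod>i\<in>J. d i)) * real CARD('a) ^ (card J div 2))"
      by (rule less.hyps) (use J less.prems IJ in auto)
    have nz: "d i \<noteq> 0" "d j \<noteq> 0" "(\<Prod>i\<in>J. d i) \<noteq> 0"
      using less.prems IJ J by auto
    let ?g = "\<lambda>((u, v), x). x(i := u, j := v)"
    have "bij_betw ?g ((UNIV \<times> UNIV) \<times> (J \<rightarrow>\<^sub>E UNIV)) (I \<rightarrow>\<^sub>E (UNIV :: 'a set))"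
      by (rule bij_betw_byWitness[where f' = "\<lambda>x. ((x i, x j), x(i := undefined, j := undefined))"])
        (use J j IJ in \<open>auto simp: PiE_iff extensional_def fun_eq_iff\<close>)
    moreover have "balanced ((UNIV \<times> UNIV) \<times> (J \<rightarrow>\<^sub>E UNIV))
        (\<lambda>(p, x). (case p of (u, v) \<Rightarrow> d i * u ^ 2 + d j * v ^ 2) + (\<Sum>i\<in>J. d i * (x i * x i)))
        ((quad_char (- (d i * d j)) * real CARD('a)) *
         (quad_char ((-1) ^ (card J div 2) * (\<Prod>i\<in>J. d i)) * real CARD('a) ^ (card J div 2)))"
      using balanced_prod[OF balanced_binary[OF odd nz(1,2)] IH] by simp
    moreover have "(\<Sum>k\<in>I. d k * (?g (p, x) k * ?g (p, x) k))
      = (case p of (u, v) \<Rightarrow> d i * u ^ 2 + d j * v ^ 2) + (\<Sum>i\<in>J. d i * (x i * x i))" for p x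
    proof -
      have "(\<Sum>k\<in>J. d k * (?g (p, x) k * ?g (p, x) k)) = (\<Sum>i\<in>J. d i * (x i * x i))"
        by (rule sum.cong) (use J j in \<open>auto split: prod.splits\<close>)
      then show ?thesis using J j by (simp add: IJ power2_eq_square split: prod.splits)
    qed
    ultimately have "balanced (I \<rightarrow>\<^sub>E UNIV) (\<lambda>x. \<Sum>i\<in>I. d i * (x i * x i))
        ((quad_char (- (d i * d j)) * real CARD('a)) *
         (quad_char ((-1) ^ (card J div 2) * (\<Prod>i\<in>J. d i)) * real CARD('a) ^ (card J div 2)))"
      by (subst (asm) balanced_reindex) auto
    also have "(quad_char (- (d i * d j)) * real CARD('a)) *
         (quad_char ((-1) ^ (card J div 2) * (\<Prod>i\<in>J. d i)) * real CARD('a) ^ (card J div 2))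
       = quad_char (- (d i * d j) * ((-1) ^ (card J div 2) * (\<Prod>i\<in>J. d i))) * real CARD('a) ^ (card I div 2)"
      using nz J by (subst quad_char_mult) auto
    also have "- (d i * d j) * ((-1) ^ (card J div 2) * (\<Prod>i\<in>J. d i))
       = (-1) ^ (card I div 2) * (\<Prod>i\<in>I. d i)"
      using J j by (simp add: IJ)
    finally show ?thesis .
  qed
qed

text \<open>\<open>E\<close> arises from the identity by adding to row \<open>i\<close> a
  combination of the other rows, hence has determinant 1, and so does its transpose.\<close>

lemma det_shear:
  fixes M :: "'n::finite \<Rightarrow> 'n \<Rightarrow> 'a::field"
  assumes "c i = 0"
  shows "det (\<chi> j k. shear M i c j k) = det (\<chi> j k. M j k)"
proof -
  define E :: "'a^'n^'n" where "E = (\<chi> j k. (if j = k then 1 else 0) + (if j = i then c k else 0))"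
  have "det E = det (mat 1 :: 'a^'n^'n)"
  proof -
    have "(\<Sum>j\<in>UNIV - {i}. c j *s row j (mat 1 :: 'a^'n^'n)) \<in> vec.span {row j (mat 1 :: 'a^'n^'n) |j. j \<noteq> i}"
      by (intro vec.span_sum vec.span_scale vec.span_base) auto
    from det_row_span[OF this] have
      "det (\<chi> k. if k = i then row i (mat 1) + (\<Sum>j\<in>UNIV - {i}. c j *s row j (mat 1 :: 'a^'n^'n))
         else row k (mat 1)) = det (mat 1 :: 'a^'n^'n)" .
    also have "(\<chi> k. if k = i then row i (mat 1) + (\<Sum>j\<in>UNIV - {i}. c j *s row j (mat 1 :: 'a^'n^'n))
         else row k (mat 1)) = E"
    proof -
      have "(\<Sum>j\<in>UNIV - {i}. c j * (if j = k then 1 else 0)) = c k" for k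
        using assms by (cases "k = i") (auto simp: if_distrib cong: if_cong)
      then show ?thesis
        by (auto simp: E_def vec_eq_iff row_def mat_def)
    qed
    finally show ?thesis .
  qed
  then have E1: "det E = 1" by simp
  have "(\<chi> j k. shear M i c j k) = transpose E ** (\<chi> j k. M j k) ** E"
  proof -
    have "(transpose E ** (\<chi> j k. M j k)) $ j $ k = M j k + c j * M i k" for j k
      by (simp add: matrix_matrix_mult_def transpose_def E_def distrib_right sum.distrib if_distrib[of "\<lambda>x. x * _"] cong: if_cong)
    then show ?thesis
      by (simp add: vec_eq_iff matrix_matrix_mult_def[of _ E] shear_def)
        (simp add: E_def distrib_left distrib_right sum.distrib if_distrib[of "\<lambda>x. _ * x"] mult.assoc cong: if_cong)
  qed
  then show ?thesis by (simp add: det_mul det_transpose E1)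
qed

interpretation sq: scaled_form "(*)" "(*) :: 'a::{finite,field} \<Rightarrow> 'a \<Rightarrow> 'a"
  by unfold_locales (auto simp: algebra_simps)

text \<open>A shear changes neither the fibre sizes nor the determinant, so diagonal matrices
  suffice. The condition on the determinant is carried through the induction because it makes the
  final diagonal entries nonzero.\<close>

lemma balanced_symmetric_matrix:
  fixes M :: "'n::finite \<Rightarrow> 'n \<Rightarrow> 'a::{finite,field}"
  assumes odd: "odd CARD('a)" and even: "even CARD('n)" and sym: "\<And>j k. M j k = M k j"
    and "det (\<chi> j k. M j k) \<noteq> 0"
  shows "balanced (UNIV \<rightarrow>\<^sub>E UNIV) (sq.mform UNIV M)
    (quad_char ((-1) ^ (CARD('n) div 2) * det (\<chi> j k. M j k)) * real CARD('a) ^ (CARD('n) div 2))"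
  using finite[of "UNIV :: 'n set"] two_neq_zero_of_odd_card[OF odd] sym assms(4)
proof (induction M rule: symmetric_shear_induct[where I = UNIV])
  case (diagonal M)
  have det: "det (\<chi> j k. M j k) = (\<Prod>i\<in>UNIV. M i i)"
    using det_diagonal[of "\<chi> j k. M j k"] diagonal by simp
  have "balanced (UNIV \<rightarrow>\<^sub>E UNIV) (\<lambda>x. \<Sum>i\<in>UNIV. M i i * (x i * x i))
    (quad_char ((-1) ^ (CARD('n) div 2) * (\<Prod>i\<in>UNIV. M i i)) * real CARD('a) ^ (CARD('n) div 2))"
    using diagonal.prems by (intro balanced_sum_squares odd even) (auto simp: det)
  moreover have "sq.mform UNIV M = (\<lambda>x. \<Sum>i\<in>UNIV. M i i * (x i * x i))"
    using sq.mform_diagonal[of UNIV M] diagonal by (auto simp: fun_eq_iff)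
  ultimately show ?case by (simp add: det)
next
  case (shear M i c)
  have bij: "bij_betw (\<lambda>x. x(i := x i + (\<Sum>j\<in>UNIV. c j * x j))) (UNIV \<rightarrow>\<^sub>E UNIV) (UNIV \<rightarrow>\<^sub>E UNIV)"
    by (rule bij_betw_shear) (use shear in auto)
  from shear show ?case
    by (subst balanced_reindex[OF bij, symmetric, where \<phi> = "sq.mform UNIV (shear M i c)"])
      (auto simp: det_shear sq.mform_shear)
qed

text \<open>Stands in for the rank: its size is the number of field elements raised to the
  corank.\<close>

definition mker :: "'i set \<Rightarrow> ('i \<Rightarrow> 'i \<Rightarrow> 'a::field) \<Rightarrow> ('i \<Rightarrow> 'a) set" where
  "mker I M = {g \<in> I \<rightarrow>\<^sub>E UNIV. \<forall>k\<in>I. (\<Sum>j\<in>I. M k j * g j) = 0}"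

text \<open>\<open>E\<close> maps the kernel of \<open>E^T M E\<close> onto the kernel of
  \<open>M\<close>. Row \<open>k\<close> of the sheared system is row \<open>k\<close> of the old
  one at \<open>E x\<close> plus \<open>c k\<close> times row \<open>i\<close>; as
  \<open>c i = 0\<close>, row \<open>i\<close> itself is unchanged and can be subtracted
  again.\<close>

lemma card_mker_shear:
  assumes "finite I" "i \<in> I" "c i = 0"
  shows "card (mker I (shear M i c)) = card (mker I M)"
proof (rule bij_betw_same_card)
  let ?g = "\<lambda>x. x(i := x i + (\<Sum>j\<in>I. c j * x j))"
  have bij: "bij_betw ?g (I \<rightarrow>\<^sub>E UNIV) (I \<rightarrow>\<^sub>E UNIV)"
    by (rule bij_betw_shear) (use assms in auto)
  have g: "(\<Sum>j\<in>I. M k j * ?g x j) = (\<Sum>j\<in>I. M k j * x j) + M k i * (\<Sum>j\<in>I. c j * x j)" for x k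
  proof -
    have "(\<Sum>j\<in>I. M k j * ?g x j)
        = (\<Sum>j\<in>I. M k j * x j + (if j = i then M k i * (\<Sum>j\<in>I. c j * x j) else 0))"
      by (rule sum.cong) (auto simp: algebra_simps)
    then show ?thesis using assms by (simp add: sum.distrib)
  qed
  have eq: "(\<Sum>j\<in>I. shear M i c k j * x j) = (\<Sum>j\<in>I. M k j * ?g x j) + c k * (\<Sum>j\<in>I. M i j * ?g x j)" for x k
    unfolding g by (simp add: shear_def algebra_simps sum.distrib sum_distrib_left)
  have iff: "(\<forall>k\<in>I. (\<Sum>j\<in>I. M k j * ?g x j) = 0)
      \<longleftrightarrow> (\<forall>k\<in>I. (\<Sum>j\<in>I. shear M i c k j * x j) = 0)" for x
  proof
    assume "\<forall>k\<in>I. (\<Sum>j\<in>I. M k j * ?g x j) = 0"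
    with assms(2) show "\<forall>k\<in>I. (\<Sum>j\<in>I. shear M i c k j * x j) = 0"
      by (simp only: eq) simp
  next
    assume *: "\<forall>k\<in>I. (\<Sum>j\<in>I. shear M i c k j * x j) = 0"
    then have "(\<Sum>j\<in>I. M i j * ?g x j) = 0" using assms(2,3) eq[of i x] by simp
    with * show "\<forall>k\<in>I. (\<Sum>j\<in>I. M k j * ?g x j) = 0"
      by (simp only: eq) simp
  qed
  show "bij_betw ?g (mker I (shear M i c)) (mker I M)"
    unfolding mker_def iff[symmetric] using bij
    by (auto simp: bij_betw_def inj_on_def image_iff simp del: fun_upd_apply)
qed

lemma card_mker_diagonal:
  fixes M :: "'i \<Rightarrow> 'i \<Rightarrow> 'a::{finite,field}"
  assumes "finite I" "\<And>j k. j \<in> I \<Longrightarrow> k \<in> I \<Longrightarrow> j \<noteq> k \<Longrightarrow> M j k = 0"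
  shows "card (mker I M) = CARD('a) ^ card {i \<in> I. M i i = 0}"
proof -
  have "(\<Sum>j\<in>I. M k j * g j) = M k k * g k" if "k \<in> I" for k g
  proof -
    have "(\<Sum>j\<in>I. M k j * g j) = (\<Sum>j\<in>I. if j = k then M k k * g k else 0)"
      by (rule sum.cong) (use assms(2) that in auto)
    then show ?thesis using assms(1) that by simp
  qed
  then have "mker I M = (\<Pi>\<^sub>E i\<in>I. if M i i = 0 then UNIV else {0})"
    unfolding mker_def by (auto simp: PiE_def Pi_iff split: if_splits)
  then have "card (mker I M) = (\<Prod>i\<in>I. if M i i = 0 then CARD('a) else 1)"
    using assms(1) by (simp add: card_PiE) (rule prod.cong, auto)
  also have "\<dots> = (\<Prod>i\<in>{i \<in> I. M i i = 0}. CARD('a))"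
    using assms(1) by (simp add: prod.If_cases Int_def)
  finally show ?thesis by simp
qed

text \<open>On a diagonal matrix the form is an orthogonal sum of multiples of \<open>b w w\<close>,
  where a zero entry contributes \<open>CARD('w)\<close> and a nonzero entry \<open>s\<close>.
  Expressing \<open>t\<close> through the kernel makes it independent of the
  diagonalisation.\<close>

lemma (in scaled_form) balanced_mform:
  fixes M :: "'i \<Rightarrow> 'i \<Rightarrow> 'a"
  assumes I: "finite I" and two: "(2::'a) \<noteq> 0" and sym: "\<And>j k. M j k = M k j"
    and "\<And>w. sm 0 w = 0" and base: "balanced UNIV (\<lambda>w. b w w) s"
  shows "\<exists>t\<le>card I. card (mker I M) = CARD('a) ^ t \<and>
    balanced (I \<rightarrow>\<^sub>E UNIV) (mform I M) (real CARD('w) ^ t * s ^ (card I - t))"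
  using I two sym
proof (induction M rule: symmetric_shear_induct)
  case (diagonal M)
  let ?Z = "{i \<in> I. M i i = 0}"
  have "balanced UNIV (\<lambda>w. M i i * b w w) (if M i i = 0 then real CARD('w) else s)" for i
    using balanced_zero[of "UNIV :: 'w set"] balanced_scale[OF base] by auto
  then have "balanced (I \<rightarrow>\<^sub>E UNIV) (\<lambda>x. \<Sum>i\<in>I. M i i * b (x i) (x i))
      (\<Prod>i\<in>I. if M i i = 0 then real CARD('w) else s)"
    by (intro balanced_PiE I)
  also have "(\<Prod>i\<in>I. if M i i = 0 then real CARD('w) else s)
      = real CARD('w) ^ card ?Z * s ^ card (I - ?Z)"
  proof -
    have "I \<inter> {i. M i i = 0} = ?Z" "I \<inter> - {i. M i i = 0} = I - ?Z" by auto
    then show ?thesis by (simp only: prod.If_cases[OF I] prod_constant)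
  qed
  also have "card (I - ?Z) = card I - card ?Z" using I by (intro card_Diff_subset) auto
  also have "(\<lambda>x. \<Sum>i\<in>I. M i i * b (x i) (x i)) = mform I M"
    using mform_diagonal[of I M] diagonal I by (auto simp: fun_eq_iff)
  finally show ?case
    using card_mker_diagonal[of I M] diagonal I card_mono[of I ?Z] by (intro exI[of _ "card ?Z"]) auto
next
  case (shear M i c)
  have bij: "bij_betw (\<lambda>x. x(i := x i + (\<Sum>j\<in>I. sm (c j) (x j)))) (I \<rightarrow>\<^sub>E UNIV) (I \<rightarrow>\<^sub>E UNIV)"
    by (rule bij_betw_shear) (use shear assms in auto)
  have "balanced (I \<rightarrow>\<^sub>E UNIV) (mform I (shear M i c)) r \<longleftrightarrow> balanced (I \<rightarrow>\<^sub>E UNIV) (mform I M) r" for r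
    by (rule balanced_reindex[OF bij]) (use I shear in \<open>simp add: mform_shear\<close>)
  with shear card_mker_shear[of I i c M] I show ?case by simp
qed

section \<open>Kernels of Hankel matrices\<close>

definition polys_upto :: "nat \<Rightarrow> 'a::zero poly set" where
  "polys_upto e = {p. degree p \<le> e}"

lemma bij_betw_coeff_polys_upto:
  "bij_betw (\<lambda>p. \<lambda>k\<in>{..e}. coeff p k) (polys_upto e) ({..e} \<rightarrow>\<^sub>E (UNIV :: 'a::comm_monoid_add set))"
proof (rule bij_betw_byWitness[where f' = "\<lambda>g. \<Sum>k\<le>e. monom (g k) k"])
  have c: "coeff (\<Sum>k\<le>e. monom (g k) k) j = (if j \<le> e then g j else 0)" for g :: "nat \<Rightarrow> 'a" and j
    by (simp add: coeff_sum)
  show "\<forall>p\<in>polys_upto e. (\<Sum>k\<le>e. monom ((\<lambda>k\<in>{..e}. coeff p k) k) k) = (p :: 'a poly)"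
    by (auto simp: poly_eq_iff c polys_upto_def coeff_eq_0)
  show "\<forall>g\<in>{..e} \<rightarrow>\<^sub>E (UNIV :: 'a set). (\<lambda>k\<in>{..e}. coeff (\<Sum>k\<le>e. monom (g k) k) k) = g"
    by (auto simp: c fun_eq_iff PiE_iff extensional_def)
  show "(\<lambda>p. \<lambda>k\<in>{..e}. coeff p k) ` polys_upto e \<subseteq> {..e} \<rightarrow>\<^sub>E (UNIV :: 'a set)"
    by (auto split: if_splits)
  show "(\<lambda>g. \<Sum>k\<le>e. monom (g k) k) ` ({..e} \<rightarrow>\<^sub>E (UNIV :: 'a set)) \<subseteq> polys_upto e"
    by (auto simp: polys_upto_def c intro!: degree_le)
qed

lemma finite_polys_upto [simp]: "finite (polys_upto e :: 'a::{finite,comm_monoid_add} poly set)"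
  using bij_betw_finite[OF bij_betw_coeff_polys_upto[where 'a = 'a, of e]] by (simp add: finite_PiE)

lemma card_polys_upto: "card (polys_upto e :: 'a::{finite,comm_monoid_add} poly set) = CARD('a) ^ Suc e"
  using bij_betw_same_card[OF bij_betw_coeff_polys_upto[where 'a = 'a, of e]] by (simp add: card_PiE)

section \<open>Linear algebra by counting in spaces of polynomials\<close>

definition poly_subspace :: "'a::field poly set \<Rightarrow> bool" where
  "poly_subspace V \<longleftrightarrow> 0 \<in> V \<and> (\<forall>p\<in>V. \<forall>r\<in>V. p + r \<in> V) \<and> (\<forall>c. \<forall>p\<in>V. smult c p \<in> V)"

lemma poly_subspace_polys_upto: "poly_subspace (polys_upto e)"
  by (auto simp: poly_subspace_def polys_upto_def degree_add_le intro: degree_smult_le[THEN order_trans])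

text \<open>Adding a suitable multiple of \<open>v\<close> carries the zero set to any other fibre,
  so all fibres have the same size.\<close>

lemma card_linear_zeros:
  fixes \<phi> :: "'a::{finite,field} poly \<Rightarrow> 'a"
  assumes V: "poly_subspace V" "finite V"
    and add: "\<And>p r. \<phi> (p + r) = \<phi> p + \<phi> r" and smult: "\<And>c p. \<phi> (smult c p) = c * \<phi> p"
    and nz: "v \<in> V" "\<phi> v \<noteq> 0"
  shows "CARD('a) * card {p \<in> V. \<phi> p = 0} = card V"
proof -
  have "card {p \<in> V. \<phi> p = c} = card {p \<in> V. \<phi> p = 0}" for c
  proof (rule bij_betw_same_card)
    let ?w = "smult (c / \<phi> v) v"
    let ?w' = "smult (- (c / \<phi> v)) v"
    have "smult a v \<in> V" for a using V nz by (auto simp: poly_subspace_def)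
    then have w: "?w \<in> V" "?w' \<in> V" by blast+
    have \<phi>w: "\<phi> ?w = c" "\<phi> ?w' = - c" "?w + ?w' = 0"
      using nz unfolding smult by simp_all
    show "bij_betw (\<lambda>p. p + ?w') {p \<in> V. \<phi> p = c} {p \<in> V. \<phi> p = 0}"
      by (rule bij_betw_byWitness[where f' = "\<lambda>p. p + ?w"])
        (use V w \<phi>w in \<open>auto simp only: poly_subspace_def add add.assoc add.commute[of ?w'] mem_Collect_eq, simp_all\<close>)
  qed
  then have "(\<Sum>c\<in>UNIV. card {p \<in> V. \<phi> p = c}) = (\<Sum>c\<in>(UNIV :: 'a set). card {p \<in> V. \<phi> p = 0})"
    by (rule sum.cong[OF refl])
  then show ?thesis using card_fibres[OF V(2), of \<phi>] by simp
qed

text \<open>Row rank equals column rank, by a double count of \<open>{(u, v). B u v = 0}\<close>.\<close>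
lemma card_kernels_pairing:
  fixes B :: "'a::{finite,field} poly \<Rightarrow> 'a poly \<Rightarrow> 'a"
  assumes U: "poly_subspace U" "finite U" and V: "poly_subspace V" "finite V"
    and add: "\<And>p r s. B (p + r) s = B p s + B r s" "\<And>p r s. B s (p + r) = B s p + B s r"
    and smult: "\<And>c p s. B (smult c p) s = c * B p s" "\<And>c p s. B s (smult c p) = c * B s p"
  shows "card {u \<in> U. \<forall>v\<in>V. B u v = 0} * card V = card {v \<in> V. \<forall>u\<in>U. B u v = 0} * card U"
proof -
  \<comment> \<open>Each \<open>u\<close> annihilates either all of \<open>Y\<close> or exactly one
    part in \<open>CARD('a)\<close> of it. Applied from both sides of the pairing, this counts the
    same pairs twice, and the common term \<open>card U * card V\<close> cancels.\<close>
  have count: "CARD('a) * (\<Sum>u\<in>X. card {v \<in> Y. C u v = 0})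
      = (CARD('a) - 1) * (card {u \<in> X. \<forall>v\<in>Y. C u v = 0} * card Y) + card X * card Y"
    if "finite X" "poly_subspace Y" "finite Y" and C: "\<And>p r s. C s (p + r) = C s p + C s r"
      "\<And>c p s. C s (smult c p) = c * C s p" for X Y :: "'a poly set" and C :: "'a poly \<Rightarrow> 'a poly \<Rightarrow> 'a"
  proof -
    let ?K = "{u \<in> X. \<forall>v\<in>Y. C u v = 0}"
    have "CARD('a) * card {v \<in> Y. C u v = 0} = (if u \<in> ?K then (CARD('a) - 1) * card Y else 0) + card Y"
      if "u \<in> X" for u
    proof (cases "u \<in> ?K")
      case True
      then have "{v \<in> Y. C u v = 0} = Y" by auto
      moreover have "CARD('a) * card Y = (CARD('a) - 1) * card Y + card Y"
        by (metis Suc_pred' add.commute mult_Suc zero_less_card_finite)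
      ultimately show ?thesis using True by simp
    next
      case False
      then obtain v where "v \<in> Y" "C u v \<noteq> 0" using \<open>u \<in> X\<close> by auto
      then have "CARD('a) * card {v \<in> Y. C u v = 0} = card Y"
        using \<open>poly_subspace Y\<close> \<open>finite Y\<close> C by (intro card_linear_zeros) auto
      then show ?thesis unfolding if_not_P[OF False] by simp
    qed
    then have "CARD('a) * (\<Sum>u\<in>X. card {v \<in> Y. C u v = 0})
        = (\<Sum>u\<in>X. (if u \<in> ?K then (CARD('a) - 1) * card Y else 0) + card Y)"
      unfolding sum_distrib_left by (intro sum.cong) auto
    also have "\<dots> = (\<Sum>u\<in>X. if u \<in> ?K then (CARD('a) - 1) * card Y else 0) + card X * card Y"
      by (simp only: sum.distrib sum_constant of_nat_id)
    also have "(\<Sum>u\<in>X. if u \<in> ?K then (CARD('a) - 1) * card Y else 0)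
        = (CARD('a) - 1) * (card ?K * card Y)"
      using \<open>finite X\<close> by (subst sum.inter_filter[symmetric]) (auto simp: ac_simps)
    finally show ?thesis .
  qed
  have "(\<Sum>u\<in>U. card {v \<in> V. B u v = 0}) = (\<Sum>v\<in>V. card {u \<in> U. B u v = 0})"
    using sum_multicount_gen[of U V "\<lambda>u v. B u v = 0" "\<lambda>v. card {u \<in> U. B u v = 0}"] U V by simp
  then have "(CARD('a) - 1) * (card {u \<in> U. \<forall>v\<in>V. B u v = 0} * card V)
      = (CARD('a) - 1) * (card {v \<in> V. \<forall>u\<in>U. B u v = 0} * card U)"
    using count[OF U(2) V, of B, OF add(2) smult(2)] count[OF V(2) U, of "\<lambda>v u. B u v", OF add(1) smult(1)]
    by (simp only: mult.commute[of "card U"])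
  moreover have "CARD('a) - 1 \<noteq> 0"
    using CARD_field_gt_1[where 'a = 'a] by simp
  ultimately show ?thesis by simp
qed

text \<open>A linear functional on polynomials of degree at most \<open>D\<close>, encoded by the
  polynomial \<alpha> whose coefficients are its values on the monomials.\<close>

definition coeff_dot :: "nat \<Rightarrow> 'a::comm_semiring_0 poly \<Rightarrow> 'a poly \<Rightarrow> 'a" where
  "coeff_dot D \<alpha> g = (\<Sum>i\<le>D. coeff \<alpha> i * coeff g i)"

text \<open>For \<open>e <= D\<close>, the kernel of the Hankel matrix of \<alpha> with
  \<open>D - e + 1\<close> rows and \<open>e + 1\<close> columns, acting on the coefficients of
  \<open>g\<close>; taking \<open>h\<close> to be a monomial gives a row. Written with products, a
  factor can be moved between \<open>g\<close> and \<open>h\<close>, which compares different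
  \<open>e\<close>.\<close>

definition hankel_ker :: "nat \<Rightarrow> 'a::field poly \<Rightarrow> nat \<Rightarrow> 'a poly set" where
  "hankel_ker D \<alpha> e = {g \<in> polys_upto e. \<forall>h\<in>polys_upto (D - e). coeff_dot D \<alpha> (g * h) = 0}"

lemma coeff_dot_add:
  "coeff_dot D (\<alpha> + \<beta>) g = coeff_dot D \<alpha> g + coeff_dot D \<beta> g"
  "coeff_dot D \<alpha> (g + h) = coeff_dot D \<alpha> g + coeff_dot D \<alpha> h"
  by (simp_all add: coeff_dot_def algebra_simps sum.distrib)

lemma coeff_dot_smult:
  "coeff_dot D (smult c \<alpha>) g = c * coeff_dot D \<alpha> g"
  "coeff_dot D \<alpha> (smult c g) = c * coeff_dot D \<alpha> g"
  by (simp_all add: coeff_dot_def sum_distrib_left ac_simps)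

lemma coeff_dot_zero: "coeff_dot D \<alpha> 0 = 0" "coeff_dot D 0 g = 0"
  by (simp_all add: coeff_dot_def)

lemma coeff_dot_monom: "i \<le> D \<Longrightarrow> coeff_dot D (monom 1 i) g = (coeff g i :: 'a::comm_semiring_1)"
  by (simp add: coeff_dot_def if_distrib[of "\<lambda>x. x * _"] cong: if_cong)

lemma poly_subspace_hankel_ker: "poly_subspace (hankel_ker D \<alpha> e)"
  using poly_subspace_polys_upto[of e, where 'a = 'a]
  by (auto simp: poly_subspace_def hankel_ker_def coeff_dot_add coeff_dot_smult coeff_dot_zero distrib_right)

lemma finite_hankel_ker [simp]: "finite (hankel_ker D \<alpha> e :: 'a::{finite,field} poly set)"
  unfolding hankel_ker_def by simp

lemma zero_in_hankel_ker: "0 \<in> hankel_ker D \<alpha> e"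
  using poly_subspace_hankel_ker[of D \<alpha> e] by (simp add: poly_subspace_def)

lemma card_hankel_ker_pos: "card (hankel_ker D (\<alpha> :: 'a::{finite,field} poly) e) > 0"
  using zero_in_hankel_ker[of D \<alpha> e] by (auto simp: card_gt_0_iff)

lemma hankel_ker_nontrivialE:
  fixes \<alpha> :: "'a::{finite,field} poly"
  assumes "card (hankel_ker D \<alpha> e) > 1"
  obtains g where "g \<in> hankel_ker D \<alpha> e" "g \<noteq> 0"
proof (rule ccontr)
  assume "\<not> thesis"
  with that have "hankel_ker D \<alpha> e \<subseteq> {0}" by blast
  then have "card (hankel_ker D \<alpha> e) \<le> card {0 :: 'a poly}" by (intro card_mono) auto
  with assms show False by simp
qed

lemma hankel_ker_mono:
  assumes "e < D"
  shows "hankel_ker D \<alpha> e \<subseteq> hankel_ker D \<alpha> (Suc e)"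
  using assms by (auto simp: hankel_ker_def polys_upto_def)

text \<open>The Hankel matrices of \<alpha> for \<open>e\<close> and for \<open>D - e\<close> are
  transposes of each other.\<close>

lemma card_hankel_ker_dual:
  fixes \<alpha> :: "'a::{finite,field} poly"
  assumes "e \<le> D"
  shows "card (hankel_ker D \<alpha> e) * CARD('a) ^ Suc (D - e)
    = card (hankel_ker D \<alpha> (D - e)) * CARD('a) ^ Suc e"
proof -
  have "hankel_ker D \<alpha> (D - e)
      = {h \<in> polys_upto (D - e). \<forall>g\<in>polys_upto e. coeff_dot D \<alpha> (g * h) = 0}"
    using assms by (auto simp: hankel_ker_def mult.commute)
  then show ?thesis
    using card_kernels_pairing[of "polys_upto e" "polys_upto (D - e)" "\<lambda>g h. coeff_dot D \<alpha> (g * h)"]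
    by (simp add: hankel_ker_def[of D \<alpha> e] poly_subspace_polys_upto coeff_dot_add coeff_dot_smult
        card_polys_upto distrib_left distrib_right)
qed

text \<open>Multiplication by the variable leads into the next kernel, since the variable can be
  moved into \<open>h\<close>. If \<open>g\<close> has the largest degree in the old kernel, its
  shift has larger degree than every old element and gives a new dimension.\<close>

lemma card_hankel_ker_Suc_ge:
  fixes \<alpha> :: "'a::{finite,field} poly"
  assumes "e < D" "card (hankel_ker D \<alpha> e) > 1"
  shows "card (hankel_ker D \<alpha> (Suc e)) \<ge> CARD('a) * card (hankel_ker D \<alpha> e)"
proof -
  let ?K = "hankel_ker D \<alpha> e"
  have "Max (degree ` ?K) \<in> degree ` ?K"
    using zero_in_hankel_ker[of D \<alpha> e] by (intro Max_in) auto
  then obtain g0 where g0: "g0 \<in> ?K" "degree g0 = Max (degree ` ?K)" by auto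
  have max: "degree h \<le> degree g0" if "h \<in> ?K" for h using that g0 by simp
  \<comment> \<open>As \<open>degree 0 = 0\<close>, the maximum may be attained at 0. Then the
    kernel contains only constants, and any nonzero one will do.\<close>
  obtain g where g: "g \<in> ?K" "g \<noteq> 0" "\<And>h. h \<in> ?K \<Longrightarrow> degree h \<le> degree g"
  proof (cases "g0 = 0")
    case True
    obtain g1 where "g1 \<in> ?K" "g1 \<noteq> 0" using hankel_ker_nontrivialE[OF assms(2)] .
    with max True that[of g1] show ?thesis by force
  qed (use that g0 max in blast)
  define f where "f = (\<lambda>(c, h). smult c (pCons 0 g) + h)"
  have lead: "coeff (f (c, h)) (Suc (degree g)) = c * lead_coeff g" if "h \<in> ?K" for c h
    using g(3)[OF that] by (simp add: f_def coeff_eq_0)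
  have "inj_on f (UNIV \<times> ?K)"
  proof (rule inj_onI, clarify)
    fix c h c' h' assume *: "h \<in> ?K" "h' \<in> ?K" "f (c, h) = f (c', h')"
    then have "c * lead_coeff g = c' * lead_coeff g" using lead by metis
    then have "c = c'" using g(2) by simp
    with * show "c = c' \<and> h = h'" by (simp add: f_def)
  qed
  moreover have "f ` (UNIV \<times> ?K) \<subseteq> hankel_ker D \<alpha> (Suc e)"
  proof clarify
    fix c h assume h: "h \<in> ?K"
    have "pCons 0 g \<in> hankel_ker D \<alpha> (Suc e)"
    proof -
      have "coeff_dot D \<alpha> (g * pCons 0 k) = 0" if "degree k \<le> D - Suc e" for k
      proof -
        have "degree (pCons 0 k) \<le> D - e"
          using that assms(1) degree_pCons_le[of 0 k] by linarith
        then show ?thesis using g(1) by (simp add: hankel_ker_def polys_upto_def del: mult_pCons_right)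
      qed
      moreover have "degree (pCons 0 g) \<le> Suc e"
        using g(1) degree_pCons_le[of 0 g] by (simp add: hankel_ker_def polys_upto_def)
      ultimately show ?thesis by (simp add: hankel_ker_def polys_upto_def)
    qed
    moreover have "h \<in> hankel_ker D \<alpha> (Suc e)" using h hankel_ker_mono[OF assms(1)] by blast
    ultimately show "f (c, h) \<in> hankel_ker D \<alpha> (Suc e)"
      using poly_subspace_hankel_ker[of D \<alpha> "Suc e"] unfolding f_def poly_subspace_def prod.case by blast
  qed
  ultimately have "card ((UNIV :: 'a set) \<times> ?K) \<le> card (hankel_ker D \<alpha> (Suc e))"
    by (intro card_inj_on_le[of f]) auto
  then show ?thesis by (simp add: card_cartesian_product)
qed

lemma card_hankel_ker_add_ge:
  fixes \<alpha> :: "'a::{finite,field} poly"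
  assumes "card (hankel_ker D \<alpha> e) > 1" "e + k \<le> D"
  shows "card (hankel_ker D \<alpha> (e + k)) \<ge> CARD('a) ^ k * card (hankel_ker D \<alpha> e)"
  using assms(2)
proof (induction k)
  case (Suc k)
  then have IH: "CARD('a) ^ k * card (hankel_ker D \<alpha> e) \<le> card (hankel_ker D \<alpha> (e + k))" by simp
  have "1 * card (hankel_ker D \<alpha> e) \<le> CARD('a) ^ k * card (hankel_ker D \<alpha> e)"
    by (rule mult_right_mono) (simp_all add: Suc_leI)
  with IH assms(1) have "card (hankel_ker D \<alpha> (e + k)) > 1" by linarith
  with Suc.prems have "CARD('a) * card (hankel_ker D \<alpha> (e + k)) \<le> card (hankel_ker D \<alpha> (Suc (e + k)))"
    by (intro card_hankel_ker_Suc_ge) auto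
  moreover have "CARD('a) * (CARD('a) ^ k * card (hankel_ker D \<alpha> e)) \<le> CARD('a) * card (hankel_ker D \<alpha> (e + k))"
    using IH by (rule mult_left_mono) simp
  ultimately show ?case by (simp only: power_Suc mult.assoc add_Suc_right)
qed simp

lemma card_hankel_ker_nontrivial_ge:
  fixes \<alpha> :: "'a::{finite,field} poly"
  assumes "card (hankel_ker D \<alpha> e) > 1"
  shows "card (hankel_ker D \<alpha> e) \<ge> CARD('a)"
proof -
  obtain g where g: "g \<in> hankel_ker D \<alpha> e" "g \<noteq> 0" using hankel_ker_nontrivialE[OF assms] .
  have "inj (\<lambda>c. smult c g)" using g(2) by (intro injI) (metis coeff_smult leading_coeff_0_iff mult_right_cancel)
  then have "card (range (\<lambda>c. smult c g)) = CARD('a)" by (rule card_image)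
  moreover have "range (\<lambda>c. smult c g) \<subseteq> hankel_ker D \<alpha> e"
    using g poly_subspace_hankel_ker[of D \<alpha> e] by (auto simp: poly_subspace_def)
  ultimately show ?thesis by (metis card_mono finite_hankel_ker)
qed

text \<open>The dual kernel \<open>hankel_ker D \<alpha> (D - e)\<close> has at most the size forced by \<open>hankel_ker D \<alpha> e\<close>,
  while the lower bound on growth holds all the way up to it. The bound cannot be exceeded anywhere
  in between.\<close>
lemma card_hankel_ker_Suc_le:
  fixes \<alpha> :: "'a::{finite,field} poly"
  assumes "2 * Suc e \<le> D"
  shows "card (hankel_ker D \<alpha> (Suc e)) \<le> CARD('a) * card (hankel_ker D \<alpha> e)"
proof (cases "card (hankel_ker D \<alpha> (Suc e)) > 1")
  case True
  let ?q = "CARD('a)" and ?k = "\<lambda>e. card (hankel_ker D \<alpha> e)"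
  \<comment> \<open>From \<open>Suc e\<close> up to \<open>D - e\<close> there are
    \<open>D - 2e - 1\<close> growth steps, while duality makes the kernel at \<open>D - e\<close>
    larger than that at \<open>e\<close> by the factor \<open>q^(D - 2e)\<close>. One factor
    \<open>q\<close> remains.\<close>
  have "?q ^ (D - e - Suc e) * ?k (Suc e) \<le> ?k (Suc e + (D - e - Suc e))"
    by (rule card_hankel_ker_add_ge[OF True]) (use assms in simp)
  also have "Suc e + (D - e - Suc e) = D - e" using assms by simp
  finally have "?q ^ (D - e - Suc e) * ?k (Suc e) * ?q ^ Suc e \<le> ?k (D - e) * ?q ^ Suc e"
    by (rule mult_right_mono) simp
  also have "\<dots> = ?k e * ?q ^ Suc (D - e)" using card_hankel_ker_dual[of e D \<alpha>] assms by simp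
  also have "Suc (D - e) = (D - e - Suc e) + Suc e + 1" using assms by simp
  finally have "?k (Suc e) * ?q ^ ((D - e - Suc e) + Suc e) \<le> ?q * ?k e * ?q ^ ((D - e - Suc e) + Suc e)"
    by (simp only: power_add power_one_right ac_simps)
  then show ?thesis by (subst (asm) mult_le_cancel2) simp
next
  case False
  moreover have "?thesis" if "card (hankel_ker D \<alpha> (Suc e)) \<le> 1"
    using that card_hankel_ker_pos[of D \<alpha> e] zero_less_card_finite[where 'a = 'a]
    by (metis One_nat_def Suc_leI le_trans mult_pos_pos)
  ultimately show ?thesis by simp
qed

text \<open>Upper and lower growth bounds agree above a nontrivial kernel. Above a trivial one the
  upper bound is \<open>q\<close>, and the scalar multiples of a nonzero element already number
  \<open>q\<close>.\<close>

lemma card_hankel_ker_Suc_eq: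
  fixes \<alpha> :: "'a::{finite,field} poly"
  assumes "2 * Suc e \<le> D" "card (hankel_ker D \<alpha> (Suc e)) > 1"
  shows "card (hankel_ker D \<alpha> (Suc e)) = CARD('a) * card (hankel_ker D \<alpha> e)"
proof (cases "card (hankel_ker D \<alpha> e) > 1")
  case True
  then show ?thesis
    using card_hankel_ker_Suc_le[OF assms(1), of \<alpha>] card_hankel_ker_Suc_ge[of e D \<alpha>] assms(1) by simp
next
  case False
  then have "card (hankel_ker D \<alpha> e) = 1" using card_hankel_ker_pos[of D \<alpha> e] by linarith
  then show ?thesis
    using card_hankel_ker_Suc_le[OF assms(1), of \<alpha>] card_hankel_ker_nontrivial_ge[OF assms(2)] by simp
qed

lemma card_hankel_ker_add_le:
  fixes \<alpha> :: "'a::{finite,field} poly"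
  assumes "2 * (e + k) \<le> D"
  shows "card (hankel_ker D \<alpha> (e + k)) \<le> CARD('a) ^ k * card (hankel_ker D \<alpha> e)"
  using assms
proof (induction k)
  case (Suc k)
  then have "card (hankel_ker D \<alpha> (Suc (e + k))) \<le> CARD('a) * card (hankel_ker D \<alpha> (e + k))"
    by (intro card_hankel_ker_Suc_le) simp
  also have "\<dots> \<le> CARD('a) * (CARD('a) ^ k * card (hankel_ker D \<alpha> e))"
    using Suc by (intro mult_left_mono) auto
  finally show ?case by (simp add: mult.assoc)
qed simp

text \<open>\<open>Suc P - t\<close> is the rank of the square Hankel matrix. A nontrivial kernel at
  \<open>e\<close> has at least \<open>q\<close> elements and grows at least by \<open>q\<close> per
  degree, so \<open>t > P - e\<close>; a trivial one grows at most by \<open>q\<close> per degree,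
  so \<open>t <= P - e\<close>.\<close>

lemma hankel_ker_rank_le_iff:
  fixes \<alpha> :: "'a::{finite,field} poly"
  assumes "card (hankel_ker (2 * P) \<alpha> P) = CARD('a) ^ t" "e \<le> P"
  shows "card (hankel_ker (2 * P) \<alpha> e) > 1 \<longleftrightarrow> Suc P - t \<le> e"
proof
  have q: "CARD('a) > 1" by (rule CARD_field_gt_1)
  {
    assume *: "card (hankel_ker (2 * P) \<alpha> e) > 1"
    have "CARD('a) ^ Suc (P - e) \<le> CARD('a) ^ (P - e) * card (hankel_ker (2 * P) \<alpha> e)"
      using card_hankel_ker_nontrivial_ge[OF *] by simp
    also have "\<dots> \<le> CARD('a) ^ t"
      using card_hankel_ker_add_ge[OF *, of "P - e"] assms by simp
    finally have "Suc (P - e) \<le> t" using q power_le_imp_le_exp by blast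
    then show "Suc P - t \<le> e" by simp
  next
    assume *: "Suc P - t \<le> e"
    show "card (hankel_ker (2 * P) \<alpha> e) > 1"
    proof (rule ccontr)
      assume "\<not> ?thesis"
      then have "CARD('a) ^ (P - e) * card (hankel_ker (2 * P) \<alpha> e) \<le> CARD('a) ^ (P - e)" by simp
      moreover have "CARD('a) ^ t \<le> CARD('a) ^ (P - e) * card (hankel_ker (2 * P) \<alpha> e)"
        using card_hankel_ker_add_le[of e "P - e" "2 * P" \<alpha>] assms by simp
      ultimately have "CARD('a) ^ t \<le> CARD('a) ^ (P - e)" by (rule order.trans[rotated])
      then have "t \<le> P - e" using q power_le_imp_le_exp by blast
      with * assms(2) show False by simp
    qed
  }
qed

text \<open>The products \<open>g * h\<close> form a space of dimension \<open>D - e + 1\<close>,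
  because \<open>g * h\<close> determines \<open>h\<close>. Its annihilator in the space of
  functionals, of dimension \<open>D + 1\<close>, has dimension \<open>e\<close>, whatever the exact
  degree of \<open>g\<close>.\<close>

lemma card_annihilator:
  fixes g :: "'a::{finite,field} poly"
  assumes "g \<noteq> 0" "degree g \<le> e" "e \<le> D"
  shows "card {\<alpha> \<in> polys_upto D. \<forall>h\<in>polys_upto (D - e). coeff_dot D \<alpha> (g * h) = 0} = CARD('a) ^ e"
proof -
  have "h = 0" if h: "h \<in> polys_upto (D - e)" "\<forall>\<alpha>\<in>polys_upto D. coeff_dot D \<alpha> (g * h) = 0" for h
  proof -
    have "degree (g * h) \<le> D" using assms h degree_mult_le[of g h] by (simp add: polys_upto_def)
    moreover have "coeff (g * h) i = 0" if "i \<le> D" for i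
      using h(2) coeff_dot_monom[OF that, of "g * h"] that
      by (auto simp: polys_upto_def degree_monom_eq dest!: bspec[of _ _ "monom 1 i"])
    ultimately have "g * h = 0" by (metis coeff_eq_0 leI le_degree leading_coeff_0_iff)
    then show ?thesis using assms(1) by simp
  qed
  then have "{h \<in> polys_upto (D - e). \<forall>\<alpha>\<in>polys_upto D. coeff_dot D \<alpha> (g * h) = 0} = {0}"
    by (auto simp: polys_upto_def coeff_dot_zero)
  then have "CARD('a) ^ Suc D = card {\<alpha> \<in> polys_upto D. \<forall>h\<in>polys_upto (D - e). coeff_dot D \<alpha> (g * h) = 0}
      * CARD('a) ^ Suc (D - e)"
    using card_kernels_pairing[of "polys_upto (D - e)" "polys_upto D" "\<lambda>h \<alpha>. coeff_dot D \<alpha> (g * h)"]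
    by (simp add: poly_subspace_polys_upto coeff_dot_add coeff_dot_smult card_polys_upto distrib_left)
  moreover have "CARD('a) ^ Suc D = CARD('a) ^ e * CARD('a) ^ Suc (D - e)"
    using assms(3) by (simp flip: power_add)
  ultimately show ?thesis by simp
qed

text \<open>Count pairs of \<alpha> and \<open>g\<close> with \<open>g\<close> fixed: 0 is
  annihilated by every functional, every other \<open>g\<close> by the same number of them.\<close>

lemma sum_card_hankel_ker:
  assumes "e \<le> D"
  shows "(\<Sum>\<alpha>\<in>polys_upto D. card (hankel_ker D (\<alpha> :: 'a::{finite,field} poly) e))
    = CARD('a) ^ Suc D + (CARD('a) ^ Suc e - 1) * CARD('a) ^ e"
proof -
  let ?A = "\<lambda>g. {\<alpha> \<in> polys_upto D. \<forall>h\<in>polys_upto (D - e). coeff_dot D \<alpha> (g * h) = (0::'a)}"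
  have zero: "0 \<in> (polys_upto e :: 'a poly set)" by (simp add: polys_upto_def)
  have "(\<Sum>\<alpha>\<in>polys_upto D. card (hankel_ker D (\<alpha> :: 'a poly) e)) = (\<Sum>g\<in>polys_upto e. card (?A g))"
    unfolding hankel_ker_def
    using sum_multicount_gen[of "polys_upto D" "polys_upto e"
        "\<lambda>\<alpha> g. \<forall>h\<in>polys_upto (D - e). coeff_dot D \<alpha> (g * h) = 0" "\<lambda>g. card (?A g)"] by simp
  also have "(\<Sum>g\<in>polys_upto e. card (?A g)) = card (?A 0) + (\<Sum>g\<in>polys_upto e - {0}. card (?A g))"
    using zero by (intro sum.remove) simp
  also have "?A 0 = polys_upto D" by (auto simp: coeff_dot_zero)
  also have "(\<Sum>g\<in>polys_upto e - {0}. card (?A g)) = (\<Sum>g\<in>polys_upto e - {0 :: 'a poly}. CARD('a) ^ e)"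
    using assms by (intro sum.cong refl card_annihilator) (auto simp: polys_upto_def)
  also have "\<dots> = (CARD('a) ^ Suc e - 1) * CARD('a) ^ e"
    using zero by (simp add: card_Diff_singleton card_polys_upto)
  finally show ?thesis by (simp add: card_polys_upto)
qed

text \<open>With \<open>k\<close> the kernel size, \<open>(k e - 1) - q * (k (e - 1) - 1)\<close> is
  \<open>q - 1\<close> if the kernel at \<open>e\<close> is nontrivial and 0 otherwise, so the total
  over all \<alpha> isolates the count. At \<open>e = 0\<close> the kernel is trivial or consists of
  all constants.\<close>

lemma card_hankel_nontrivial:
  assumes "e \<le> P"
  shows "card {\<alpha> \<in> polys_upto (2 * P). card (hankel_ker (2 * P) (\<alpha> :: 'a::{finite,field} poly) e) > 1}
    = CARD('a) ^ (2 * e)"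
proof -
  let ?q = "real CARD('a)" and ?k = "\<lambda>e \<alpha>. card (hankel_ker (2 * P) (\<alpha> :: 'a poly) e)"
  let ?L = "polys_upto (2 * P) :: 'a poly set"
  have q: "?q > 1" using CARD_field_gt_1[where 'a = 'a] by simp
  have total: "(\<Sum>\<alpha>\<in>?L. real (?k d \<alpha>) - 1) = (?q ^ Suc d - 1) * ?q ^ d" if "d \<le> P" for d
  proof -
    have "(\<Sum>\<alpha>\<in>?L. real (?k d \<alpha>) - 1) = real (\<Sum>\<alpha>\<in>?L. ?k d \<alpha>) - ?q ^ Suc (2 * P)"
      by (simp add: sum_subtractf card_polys_upto)
    also have "real (\<Sum>\<alpha>\<in>?L. ?k d \<alpha>) = real (CARD('a) ^ Suc (2 * P) + (CARD('a) ^ Suc d - 1) * CARD('a) ^ d)"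
      using that by (subst sum_card_hankel_ker) auto
    also have "\<dots> = ?q ^ Suc (2 * P) + (?q ^ Suc d - 1) * ?q ^ d"
      using one_le_power[of "CARD('a)" "Suc d"] by (simp add: of_nat_diff Suc_leI)
    finally show ?thesis by simp
  qed
  have count: "(\<Sum>\<alpha>\<in>?L. if ?k e \<alpha> > 1 then ?q - 1 else 0) = (?q - 1) * real (card {\<alpha> \<in> ?L. ?k e \<alpha> > 1})"
    by (subst sum.inter_filter[symmetric]) auto
  show ?thesis
  proof (cases e)
    case 0
    have "real (?k 0 \<alpha>) - 1 = (if ?k 0 \<alpha> > 1 then ?q - 1 else 0)" for \<alpha>
    proof -
      have "?k 0 \<alpha> \<le> card (polys_upto 0 :: 'a poly set)"
        by (rule card_mono) (auto simp: hankel_ker_def)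
      then show ?thesis
        using card_hankel_ker_nontrivial_ge[of "2 * P" \<alpha> 0] card_hankel_ker_pos[of "2 * P" \<alpha> 0]
        by (auto simp: card_polys_upto)
    qed
    then have "(?q - 1) * real (card {\<alpha> \<in> ?L. ?k e \<alpha> > 1}) = (?q - 1) * 1"
      using total[of 0] count 0 by simp
    then show ?thesis using q 0 by simp
  next
    case (Suc d)
    have "(if ?k e \<alpha> > 1 then ?q - 1 else 0) = (real (?k e \<alpha>) - 1) - ?q * (real (?k d \<alpha>) - 1)" for \<alpha>
    proof (cases "?k e \<alpha> > 1")
      case True
      then have "?k e \<alpha> = CARD('a) * ?k d \<alpha>"
        using card_hankel_ker_Suc_eq[of d "2 * P" \<alpha>] Suc assms by simp
      then show ?thesis using True by (simp add: algebra_simps)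
    next
      case False
      then have "?k e \<alpha> = 1" using card_hankel_ker_pos[of "2 * P" \<alpha> e] by simp
      moreover have "?k d \<alpha> \<le> ?k e \<alpha>"
        unfolding Suc by (intro card_mono hankel_ker_mono) (use Suc assms in auto)
      moreover have "?k d \<alpha> > 0" by (rule card_hankel_ker_pos)
      ultimately have "?k d \<alpha> = 1" by linarith
      with \<open>?k e \<alpha> = 1\<close> show ?thesis by simp
    qed
    then have "(?q - 1) * real (card {\<alpha> \<in> ?L. ?k e \<alpha> > 1})
        = (\<Sum>\<alpha>\<in>?L. real (?k e \<alpha>) - 1) - ?q * (\<Sum>\<alpha>\<in>?L. real (?k d \<alpha>) - 1)"
      unfolding count[symmetric] by (simp add: sum_subtractf flip: sum_distrib_left)
    also have "\<dots> = (?q - 1) * ?q ^ (2 * e)"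
    proof -
      have "(\<Sum>\<alpha>\<in>?L. real (?k e \<alpha>) - 1) - ?q * (\<Sum>\<alpha>\<in>?L. real (?k d \<alpha>) - 1)
          = (?q ^ Suc e - 1) * ?q ^ e - ?q * ((?q ^ Suc d - 1) * ?q ^ d)"
        by (subst (1 2) total) (use assms Suc in simp_all)
      also have "\<dots> = (?q - 1) * ?q ^ (2 * e)"
        by (simp add: Suc mult_2_right power_add algebra_simps)
      finally show ?thesis .
    qed
    finally have "real (card {\<alpha> \<in> ?L. ?k e \<alpha> > 1}) = real (CARD('a) ^ (2 * e))" using q by simp
    then show ?thesis by (simp only: of_nat_eq_iff)
  qed
qed

section \<open>Zeros of bounded degree\<close>

lemma coeff_dot_sum: "coeff_dot D \<alpha> (\<Sum>i\<in>I. g i) = (\<Sum>i\<in>I. coeff_dot D \<alpha> (g i))"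
  by (induction I rule: infinite_finite_induct) (simp_all add: coeff_dot_zero coeff_dot_add)

lemma coeff_dot_mult:
  fixes g h :: "'a::comm_ring_1 poly"
  assumes "degree g \<le> P" "degree h \<le> P"
  shows "coeff_dot (2 * P) \<alpha> (g * h) = (\<Sum>j\<le>P. \<Sum>k\<le>P. coeff \<alpha> (j + k) * (coeff g j * coeff h k))"
proof -
  have m: "coeff_dot (2 * P) \<alpha> (monom c m) = coeff \<alpha> m * c" if "m \<le> 2 * P" for c m
    using that by (simp add: coeff_dot_def if_distrib[of "\<lambda>x. _ * x"] cong: if_cong)
  have "g * h = (\<Sum>j\<le>P. monom (coeff g j) j) * (\<Sum>k\<le>P. monom (coeff h k) k)"
    using poly_as_sum_of_monoms'[OF assms(1)] poly_as_sum_of_monoms'[OF assms(2)] by simp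
  also have "\<dots> = (\<Sum>j\<le>P. \<Sum>k\<le>P. monom (coeff g j * coeff h k) (j + k))"
    by (simp add: sum_product mult_monom)
  finally show ?thesis by (simp add: coeff_dot_sum m)
qed

text \<open>Testing against all \<open>h\<close> of degree at most \<open>P\<close> amounts to
  testing against monomials, and the monomial of degree \<open>k\<close> gives row \<open>k\<close>
  of the matrix.\<close>

lemma card_hankel_ker_eq_mker:
  fixes \<alpha> :: "'a::{finite,field} poly"
  shows "card (hankel_ker (2 * P) \<alpha> P) = card (mker {..P} (\<lambda>j k. coeff \<alpha> (j + k)))"
proof (rule bij_betw_same_card)
  let ?g = "\<lambda>p. \<lambda>k\<in>{..P}. coeff p k"
  have iff: "(\<forall>h\<in>polys_upto P. coeff_dot (2 * P) \<alpha> (g * h) = 0)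
      \<longleftrightarrow> (\<forall>k\<in>{..P}. (\<Sum>j\<in>{..P}. coeff \<alpha> (k + j) * ?g g j) = 0)" if "g \<in> polys_upto P" for g
  proof -
    have eq: "coeff_dot (2 * P) \<alpha> (g * h) = (\<Sum>k\<le>P. (\<Sum>j\<le>P. coeff \<alpha> (k + j) * ?g g j) * coeff h k)"
      if "h \<in> polys_upto P" for h
    proof -
      have "coeff_dot (2 * P) \<alpha> (g * h) = (\<Sum>j\<le>P. \<Sum>k\<le>P. coeff \<alpha> (j + k) * (coeff g j * coeff h k))"
        using that \<open>g \<in> polys_upto P\<close> by (intro coeff_dot_mult) (auto simp: polys_upto_def)
      also have "\<dots> = (\<Sum>k\<le>P. \<Sum>j\<le>P. coeff \<alpha> (j + k) * (coeff g j * coeff h k))"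
        by (rule sum.swap)
      finally show ?thesis by (simp add: sum_distrib_right add.commute mult.assoc)
    qed
    show ?thesis
    proof
      assume *: "\<forall>h\<in>polys_upto P. coeff_dot (2 * P) \<alpha> (g * h) = 0"
      show "\<forall>k\<in>{..P}. (\<Sum>j\<in>{..P}. coeff \<alpha> (k + j) * ?g g j) = 0"
      proof
        fix k assume k: "k \<in> {..P}"
        then have mem: "monom (1::'a) k \<in> polys_upto P" by (simp add: polys_upto_def degree_monom_eq)
        then have "0 = (\<Sum>i\<le>P. (\<Sum>j\<le>P. coeff \<alpha> (i + j) * ?g g j) * coeff (monom 1 k) i)"
          using * eq[OF mem] by simp
        also have "\<dots> = (\<Sum>i\<le>P. if i = k then \<Sum>j\<le>P. coeff \<alpha> (k + j) * ?g g j else 0)"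
          by (rule sum.cong) auto
        finally show "(\<Sum>j\<in>{..P}. coeff \<alpha> (k + j) * ?g g j) = 0" using k by simp
      qed
    next
      assume "\<forall>k\<in>{..P}. (\<Sum>j\<in>{..P}. coeff \<alpha> (k + j) * ?g g j) = 0"
      then show "\<forall>h\<in>polys_upto P. coeff_dot (2 * P) \<alpha> (g * h) = 0"
        by (auto simp only: eq intro!: sum.neutral) simp
    qed
  qed
  have "hankel_ker (2 * P) \<alpha> P
      = {g \<in> polys_upto P. \<forall>k\<in>{..P}. (\<Sum>j\<in>{..P}. coeff \<alpha> (k + j) * ?g g j) = 0}"
    using iff by (auto simp: hankel_ker_def simp del: restrict_apply)
  then show "bij_betw ?g (hankel_ker (2 * P) \<alpha> P) (mker {..P} (\<lambda>j k. coeff \<alpha> (j + k)))"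
    using bij_betw_coeff_polys_upto[of P, where 'a = 'a]
    by (auto simp: mker_def bij_betw_def inj_on_def image_iff simp del: restrict_apply)
qed

section \<open>Quadratic forms on vectors of polynomials of bounded degree\<close>

definition poly_vecs :: "nat \<Rightarrow> ('n::finite \<Rightarrow> 'a::zero poly) set" where
  "poly_vecs P = {x. \<forall>i. degree (x i) \<le> P}"

text \<open>A vector of polynomials is regarded as a polynomial with vector coefficients. In this
  shape the Hankel matrix acts on the coefficient index and \<open>A\<close> on each
  coefficient.\<close>

lemma bij_betw_poly_vecs:
  "bij_betw (\<lambda>x. \<lambda>k\<in>{..P}. \<chi> i. coeff (x i) k) (poly_vecs P)
     ({..P} \<rightarrow>\<^sub>E (UNIV :: ('a::comm_ring_1 ^ 'n::finite) set))"
proof (rule bij_betw_byWitness[where f' = "\<lambda>y i. \<Sum>k\<le>P. monom (y k $ i) k"])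
  have c: "coeff (\<Sum>k\<le>P. monom (y k $ i) k) j = (if j \<le> P then y j $ i else 0)"
    for y :: "nat \<Rightarrow> 'a ^ 'n" and i j
    by (simp add: coeff_sum)
  show "\<forall>x\<in>poly_vecs P. (\<lambda>i. \<Sum>k\<le>P. monom ((\<lambda>k\<in>{..P}. \<chi> i. coeff (x i) k) k $ i) k) = (x :: 'n \<Rightarrow> 'a poly)"
    by (auto simp: poly_vecs_def fun_eq_iff poly_as_sum_of_monoms')
  show "\<forall>y\<in>{..P} \<rightarrow>\<^sub>E (UNIV :: ('a ^ 'n) set).
      (\<lambda>k\<in>{..P}. \<chi> i. coeff (\<Sum>k\<le>P. monom (y k $ i) k) k) = y"
    by (auto simp: c fun_eq_iff PiE_iff extensional_def)
  show "(\<lambda>x. \<lambda>k\<in>{..P}. \<chi> i. coeff (x i) k) ` poly_vecs P \<subseteq> {..P} \<rightarrow>\<^sub>E (UNIV :: ('a ^ 'n) set)"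
    by (auto split: if_splits)
  show "(\<lambda>y i. \<Sum>k\<le>P. monom (y k $ i) k) ` ({..P} \<rightarrow>\<^sub>E (UNIV :: ('a ^ 'n) set)) \<subseteq> poly_vecs P"
    by (auto simp: poly_vecs_def c intro!: degree_le)
qed

lemma finite_poly_vecs [simp]: "finite (poly_vecs P :: ('n::finite \<Rightarrow> 'a::{finite,comm_ring_1} poly) set)"
  using bij_betw_finite[OF bij_betw_poly_vecs[where 'a = 'a and 'n = 'n, of P]] by (simp add: finite_PiE)

lemma degree_qf_eval_le:
  assumes "x \<in> poly_vecs P"
  shows "degree (qf_eval A x) \<le> 2 * P"
  unfolding qf_eval_def
proof (intro degree_sum_le)
  fix i j
  have "degree ([:A $ i $ j:] * x i * x j) \<le> degree ([:A $ i $ j:] * x i) + degree (x j)"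
    by (rule degree_mult_le)
  also have "degree ([:A $ i $ j:] * x i) \<le> degree [:A $ i $ j:] + degree (x i)" by (rule degree_mult_le)
  also have "degree [:A $ i $ j:] + degree (x i) + degree (x j) \<le> 0 + P + P"
    using assms by (intro add_mono) (auto simp: poly_vecs_def)
  finally show "degree ([:A $ i $ j:] * x i * x j) \<le> 2 * P" by simp
qed simp_all

lemma coeff_dot_qf_eval:
  fixes A :: "'a::comm_ring_1 ^ 'n::finite ^ 'n"
  assumes "x \<in> poly_vecs P"
  shows "coeff_dot (2 * P) \<alpha> (qf_eval A x) = (\<Sum>j\<le>P. \<Sum>k\<le>P. coeff \<alpha> (j + k) *
    (\<Sum>i\<in>UNIV. \<Sum>l\<in>UNIV. A $ i $ l * (coeff (x i) j * coeff (x l) k)))"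
proof -
  have "coeff_dot (2 * P) \<alpha> (qf_eval A x)
      = (\<Sum>i\<in>UNIV. \<Sum>l\<in>UNIV. A $ i $ l * coeff_dot (2 * P) \<alpha> (x i * x l))"
    by (simp add: qf_eval_def coeff_dot_sum coeff_dot_smult)
  also have "\<dots> = (\<Sum>i\<in>UNIV. \<Sum>l\<in>UNIV. \<Sum>j\<le>P. \<Sum>k\<le>P. coeff \<alpha> (j + k) *
      (A $ i $ l * (coeff (x i) j * coeff (x l) k)))"
  proof (intro sum.cong refl)
    fix i l
    have "coeff_dot (2 * P) \<alpha> (x i * x l)
        = (\<Sum>j\<le>P. \<Sum>k\<le>P. coeff \<alpha> (j + k) * (coeff (x i) j * coeff (x l) k))"
      using assms by (intro coeff_dot_mult) (auto simp: poly_vecs_def)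
    then show "A $ i $ l * coeff_dot (2 * P) \<alpha> (x i * x l)
        = (\<Sum>j\<le>P. \<Sum>k\<le>P. coeff \<alpha> (j + k) * (A $ i $ l * (coeff (x i) j * coeff (x l) k)))"
      by (simp add: sum_distrib_left mult.left_commute[of "A $ i $ l"])
  qed
  also have "\<dots> = (\<Sum>i\<in>UNIV. \<Sum>j\<le>P. \<Sum>k\<le>P. \<Sum>l\<in>UNIV. coeff \<alpha> (j + k) *
      (A $ i $ l * (coeff (x i) j * coeff (x l) k)))"
    by (rule sum.cong[OF refl], subst sum.swap, rule sum.cong[OF refl], rule sum.swap)
  also have "\<dots> = (\<Sum>j\<le>P. \<Sum>k\<le>P. \<Sum>i\<in>UNIV. \<Sum>l\<in>UNIV. coeff \<alpha> (j + k) *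
      (A $ i $ l * (coeff (x i) j * coeff (x l) k)))"
    by (subst sum.swap, rule sum.cong[OF refl], rule sum.swap)
  finally show ?thesis by (simp add: sum_distrib_left)
qed

definition bil :: "'a::comm_ring_1 ^ 'n::finite ^ 'n \<Rightarrow> 'a ^ 'n \<Rightarrow> 'a ^ 'n \<Rightarrow> 'a" where
  "bil A x y = (\<Sum>i\<in>UNIV. \<Sum>j\<in>UNIV. A $ i $ j * (x $ i * y $ j))"

lemma scaled_form_bil: "scaled_form (*s) (bil (A :: 'a::{finite,field} ^ 'n::finite ^ 'n))"
  by unfold_locales (simp_all add: bil_def algebra_simps sum.distrib sum_distrib_left)

lemma balanced_bil:
  fixes A :: "'a::{finite,field} ^ 'n::finite ^ 'n"
  assumes odd: "odd CARD('a)" and even: "even CARD('n)" and sym: "transpose A = A" and det: "det A \<noteq> 0"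
  shows "balanced UNIV (\<lambda>w. bil A w w)
    (quad_char ((-1) ^ (CARD('n) div 2) * det A) * real CARD('a) ^ (CARD('n) div 2))"
proof -
  have "bij_betw vec_nth (UNIV :: ('a ^ 'n) set) (UNIV \<rightarrow>\<^sub>E UNIV)"
    by (rule bij_betw_byWitness[where f' = vec_lambda]) auto
  moreover have "A $ j $ k = A $ k $ j" for j k
    using sym by (metis transpose_def vec_lambda_beta)
  then have "balanced (UNIV \<rightarrow>\<^sub>E UNIV) (sq.mform UNIV (\<lambda>j k. A $ j $ k))
    (quad_char ((-1) ^ (CARD('n) div 2) * det (\<chi> j k. A $ j $ k)) * real CARD('a) ^ (CARD('n) div 2))"
    using det by (intro balanced_symmetric_matrix odd even) auto
  ultimately show ?thesis
    by (subst balanced_reindex[where \<psi> = "sq.mform UNIV (\<lambda>j k. A $ j $ k)"]) (auto simp: bil_def sq.mform_def)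
qed

text \<open>The Hankel matrix of \<open>\<alpha>\<close> tensored with \<open>A\<close> represents \<open>\<alpha> \<circ> f\<close>; \<open>r\<close> is its rank.\<close>
lemma balanced_coeff_dot_qf_eval:
  fixes A :: "'a::{finite,field} ^ 'n::finite ^ 'n"
  assumes odd: "odd CARD('a)" and base: "balanced UNIV (\<lambda>w. bil A w w) s"
  shows "\<exists>r\<le>Suc P. card (hankel_ker (2 * P) \<alpha> P) = CARD('a) ^ (Suc P - r) \<and>
    balanced (poly_vecs P) (\<lambda>x. coeff_dot (2 * P) \<alpha> (qf_eval A x))
      (real CARD('a ^ 'n) ^ (Suc P - r) * s ^ r)"
proof -
  interpret B: scaled_form "(*s)" "bil A" by (rule scaled_form_bil)
  let ?H = "\<lambda>j k. coeff \<alpha> (j + k)"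
  obtain t where t: "t \<le> Suc P" "card (mker {..P} ?H) = CARD('a) ^ t"
    "balanced ({..P} \<rightarrow>\<^sub>E UNIV) (B.mform {..P} ?H) (real CARD('a ^ 'n) ^ t * s ^ (Suc P - t))"
    using B.balanced_mform[of "{..P}" ?H s] two_neq_zero_of_odd_card[OF odd] base
    by (auto simp: add.commute)
  have "balanced (poly_vecs P) (\<lambda>x. coeff_dot (2 * P) \<alpha> (qf_eval A x)) (real CARD('a ^ 'n) ^ t * s ^ (Suc P - t))"
    using t(3) by (subst balanced_reindex[OF bij_betw_poly_vecs, where \<psi> = "B.mform {..P} ?H"])
      (auto simp: coeff_dot_qf_eval B.mform_def bil_def)
  with t show ?thesis
    by (intro exI[of _ "Suc P - t"]) (auto simp: card_hankel_ker_eq_mker)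
qed

text \<open>The rank distribution is known cumulatively, as the number of matrices of rank at most
  \<open>e\<close>, so each level is a difference of two cumulative counts.\<close>

lemma sum_by_level:
  fixes f :: "nat \<Rightarrow> real"
  assumes fin: "finite L" and le: "\<And>x. x \<in> L \<Longrightarrow> r x \<le> m"
  shows "(\<Sum>x\<in>L. f (r x)) = f 0 * real (card {x \<in> L. r x \<le> 0})
    + (\<Sum>k<m. f (Suc k) * (real (card {x \<in> L. r x \<le> Suc k}) - real (card {x \<in> L. r x \<le> k})))"
proof -
  have level: "real (card {x \<in> L. r x = Suc k})
      = real (card {x \<in> L. r x \<le> Suc k}) - real (card {x \<in> L. r x \<le> k})" for k
  proof -
    have "{x \<in> L. r x \<le> Suc k} = {x \<in> L. r x \<le> k} \<union> {x \<in> L. r x = Suc k}" by auto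
    moreover have "card ({x \<in> L. r x \<le> k} \<union> {x \<in> L. r x = Suc k})
        = card {x \<in> L. r x \<le> k} + card {x \<in> L. r x = Suc k}"
      using fin by (intro card_Un_disjoint) auto
    ultimately show ?thesis by simp
  qed
  have "(\<Sum>x\<in>L. f (r x)) = (\<Sum>k\<in>{..m}. \<Sum>x\<in>{x \<in> L. r x = k}. f (r x))"
    using fin le by (intro sum.group[symmetric]) auto
  also have "\<dots> = (\<Sum>k\<le>m. f k * real (card {x \<in> L. r x = k}))"
    by (rule sum.cong) auto
  also have "\<dots> = f 0 * real (card {x \<in> L. r x = 0})
      + (\<Sum>k<m. f (Suc k) * real (card {x \<in> L. r x = Suc k}))"
    by (subst sum.atMost_shift) simp
  finally show ?thesis by (simp add: level)
qed

text \<open>Counting the pairs \<open>(\<alpha>, x)\<close> with \<open>\<alpha> \<circ> f (x) = 0\<close> replaces the orthogonality of additive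
  characters in the circle method.\<close>
lemma card_zeros_circle:
  fixes A :: "'a::{finite,field} ^ 'n::finite ^ 'n"
  assumes bal: "\<And>\<alpha>. balanced (poly_vecs P) (\<lambda>x. coeff_dot (2 * P) \<alpha> (qf_eval A x)) (s \<alpha>)"
  shows "real CARD('a) ^ Suc (2 * P) * real (card {x \<in> poly_vecs P. qf_eval A x = 0})
    = (\<Sum>\<alpha>\<in>polys_upto (2 * P). s \<alpha>)"
proof -
  let ?q = "real CARD('a)" and ?L = "polys_upto (2 * P) :: 'a poly set"
    and ?X = "poly_vecs P :: ('n \<Rightarrow> 'a poly) set"
  have q: "?q > 1" using CARD_field_gt_1[where 'a = 'a] by simp
  have inner: "?q * real (card {\<alpha> \<in> ?L. coeff_dot (2 * P) \<alpha> (qf_eval A x) = 0})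
      = ?q ^ Suc (2 * P) + (if qf_eval A x = 0 then (?q - 1) * ?q ^ Suc (2 * P) else 0)"
    if x: "x \<in> ?X" for x
  proof (cases "qf_eval A x = 0")
    case True
    then have "{\<alpha> \<in> ?L. coeff_dot (2 * P) \<alpha> (qf_eval A x) = 0} = ?L" by (simp add: coeff_dot_zero)
    then show ?thesis using True by (simp add: card_polys_upto algebra_simps)
  next
    case False
    \<comment> \<open>The functional that reads off the leading coefficient does not vanish. It is
      available because the degree is at most \<open>2 * P\<close>.\<close>
    let ?i = "degree (qf_eval A x)"
    have i: "?i \<le> 2 * P" using x by (rule degree_qf_eval_le)
    have "CARD('a) * card {\<alpha> \<in> ?L. coeff_dot (2 * P) \<alpha> (qf_eval A x) = 0} = card ?L"
    proof (rule card_linear_zeros)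
      show "monom 1 ?i \<in> ?L" using i by (simp add: polys_upto_def degree_monom_eq)
      show "coeff_dot (2 * P) (monom 1 ?i) (qf_eval A x) \<noteq> 0" using i False by (simp add: coeff_dot_monom)
    qed (simp_all add: poly_subspace_polys_upto coeff_dot_add coeff_dot_smult)
    then show ?thesis using False by (simp add: card_polys_upto flip: of_nat_mult of_nat_power)
  qed
  have "(\<Sum>\<alpha>\<in>?L. card {x \<in> ?X. coeff_dot (2 * P) \<alpha> (qf_eval A x) = 0})
      = (\<Sum>x\<in>?X. card {\<alpha> \<in> ?L. coeff_dot (2 * P) \<alpha> (qf_eval A x) = 0})"
    using sum_multicount_gen[of ?L ?X "\<lambda>\<alpha> x. coeff_dot (2 * P) \<alpha> (qf_eval A x) = 0"
        "\<lambda>x. card {\<alpha> \<in> ?L. coeff_dot (2 * P) \<alpha> (qf_eval A x) = 0}"] by simp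
  then have "(\<Sum>\<alpha>\<in>?L. ?q * real (card {x \<in> ?X. coeff_dot (2 * P) \<alpha> (qf_eval A x) = 0}))
      = (\<Sum>x\<in>?X. ?q * real (card {\<alpha> \<in> ?L. coeff_dot (2 * P) \<alpha> (qf_eval A x) = 0}))"
    by (simp flip: sum_distrib_left of_nat_sum)
  moreover have "(\<Sum>\<alpha>\<in>?L. ?q * real (card {x \<in> ?X. coeff_dot (2 * P) \<alpha> (qf_eval A x) = 0}))
      = ?q ^ Suc (2 * P) * real (card ?X) + (?q - 1) * (\<Sum>\<alpha>\<in>?L. s \<alpha>)"
    by (simp only: balanced_card_zeros[OF bal] sum.distrib sum_constant card_polys_upto
        sum_distrib_left of_nat_power)
  moreover have "(\<Sum>x\<in>?X. ?q * real (card {\<alpha> \<in> ?L. coeff_dot (2 * P) \<alpha> (qf_eval A x) = 0}))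
      = ?q ^ Suc (2 * P) * real (card ?X)
        + (?q - 1) * (?q ^ Suc (2 * P) * real (card {x \<in> ?X. qf_eval A x = 0}))"
  proof -
    have "(\<Sum>x\<in>?X. ?q * real (card {\<alpha> \<in> ?L. coeff_dot (2 * P) \<alpha> (qf_eval A x) = 0}))
        = (\<Sum>x\<in>?X. ?q ^ Suc (2 * P) + (if qf_eval A x = 0 then (?q - 1) * ?q ^ Suc (2 * P) else 0))"
      by (rule sum.cong[OF refl inner])
    also have "\<dots> = (\<Sum>x\<in>?X. ?q ^ Suc (2 * P))
        + (\<Sum>x\<in>{x \<in> ?X. qf_eval A x = 0}. (?q - 1) * ?q ^ Suc (2 * P))"
      by (simp only: sum.distrib sum.inter_filter[OF finite_poly_vecs])
    finally show ?thesis by (simp only: sum_constant mult_ac)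
  qed
  ultimately have "(?q - 1) * (?q ^ Suc (2 * P) * real (card {x \<in> ?X. qf_eval A x = 0}))
      = (?q - 1) * (\<Sum>\<alpha>\<in>?L. s \<alpha>)" by linarith
  then show ?thesis using q by simp
qed

text \<open>The last summand is separate because all \<open>q ^ (2 * P + 1)\<close> matrices have
  rank at most \<open>P + 1\<close>, where the pattern of the lower ranks would give
  \<open>q ^ (2 * P + 2)\<close>.\<close>

lemma card_poly_zeros:
  fixes A :: "'a::{finite,field} ^ 'n::finite ^ 'n"
  assumes odd: "odd CARD('a)" and base: "balanced UNIV (\<lambda>w. bil A w w) s"
  defines "q \<equiv> real CARD('a)" and "Q \<equiv> real CARD('a ^ 'n)"
  shows "q ^ Suc (2 * P) * real (card {x \<in> poly_vecs P. qf_eval A x = 0})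
    = Q ^ Suc P + (\<Sum>k<P. Q ^ (P - k) * s ^ Suc k * (q ^ (2 * Suc k) - q ^ (2 * k)))
      + s ^ Suc P * (q ^ Suc (2 * P) - q ^ (2 * P))"
proof -
  let ?L = "polys_upto (2 * P) :: 'a poly set"
  from balanced_coeff_dot_qf_eval[OF odd base] obtain r where
    r: "r \<alpha> \<le> Suc P" "card (hankel_ker (2 * P) \<alpha> P) = CARD('a) ^ (Suc P - r \<alpha>)"
    "balanced (poly_vecs P) (\<lambda>x. coeff_dot (2 * P) \<alpha> (qf_eval A x)) (Q ^ (Suc P - r \<alpha>) * s ^ r \<alpha>)" for \<alpha>
    unfolding Q_def by metis
  have N: "real (card {\<alpha> \<in> ?L. r \<alpha> \<le> e}) = q ^ (2 * e)" if "e \<le> P" for e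
  proof -
    have "r \<alpha> \<le> e \<longleftrightarrow> card (hankel_ker (2 * P) \<alpha> e) > 1" for \<alpha>
      using hankel_ker_rank_le_iff[OF r(2) that, of \<alpha>] r(1)[of \<alpha>] by simp
    then show ?thesis using card_hankel_nontrivial[OF that, where 'a = 'a] by (simp add: q_def)
  qed
  have top: "real (card {\<alpha> \<in> ?L. r \<alpha> \<le> Suc P}) = q ^ Suc (2 * P)"
    using r(1) by (simp add: card_polys_upto q_def)
  have "q ^ Suc (2 * P) * real (card {x \<in> poly_vecs P. qf_eval A x = 0})
      = (\<Sum>\<alpha>\<in>?L. (\<lambda>k. Q ^ (Suc P - k) * s ^ k) (r \<alpha>))"
    unfolding q_def by (rule card_zeros_circle) (rule r(3))
  also have "\<dots> = Q ^ Suc P * real (card {\<alpha> \<in> ?L. r \<alpha> \<le> 0})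
      + (\<Sum>k<Suc P. Q ^ (P - k) * s ^ Suc k *
          (real (card {\<alpha> \<in> ?L. r \<alpha> \<le> Suc k}) - real (card {\<alpha> \<in> ?L. r \<alpha> \<le> k})))"
    using sum_by_level[of ?L r "Suc P" "\<lambda>k. Q ^ (Suc P - k) * s ^ k"] r(1) by simp
  also have "\<dots> = Q ^ Suc P + (\<Sum>k<P. Q ^ (P - k) * s ^ Suc k * (q ^ (2 * Suc k) - q ^ (2 * k)))
      + s ^ Suc P * (q ^ Suc (2 * P) - q ^ (2 * P))"
    unfolding sum.lessThan_Suc top using N[of 0] N[of P] by (simp add: N)
  finally show ?thesis .
qed

section \<open>Primitive zeros\<close>

text \<open>A nonzero element of least degree in the ideal generated by the family divides every
  member, by division with remainder, and is therefore a unit.\<close>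

lemma poly_family_bezout:
  fixes y :: "'n::finite \<Rightarrow> 'a::field poly"
  assumes "poly_family_coprime y"
  shows "\<exists>u. (\<Sum>i\<in>UNIV. u i * y i) = 1"
proof -
  define I where "I = range (\<lambda>u. \<Sum>i\<in>UNIV. u i * y i)"
  have I_y: "y i \<in> I" for i
    unfolding I_def by (rule image_eqI[of _ _ "\<lambda>j. if j = i then 1 else 0"]) (auto simp: if_distrib[of "\<lambda>x. x * _"] cong: if_cong)
  have I_diff: "p - r * d \<in> I" if "p \<in> I" "d \<in> I" for p d r
  proof -
    from that obtain v w where "p = (\<Sum>i\<in>UNIV. v i * y i)" "d = (\<Sum>i\<in>UNIV. w i * y i)"
      unfolding I_def by blast
    then have "p - r * d = (\<Sum>i\<in>UNIV. (v i - r * w i) * y i)"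
      by (simp add: algebra_simps sum_subtractf sum_distrib_left)
    then have "\<exists>u. p - r * d = (\<Sum>i\<in>UNIV. u i * y i)" by (rule exI[of _ "\<lambda>i. v i - r * w i"])
    then show ?thesis by (auto simp: I_def)
  qed
  have "\<exists>i. y i \<noteq> 0"
  proof (rule ccontr)
    assume "\<nexists>i. y i \<noteq> 0"
    then have "is_unit (0 :: 'a poly)" using assms unfolding poly_family_coprime_def by simp
    then show False by simp
  qed
  then have "\<exists>d. d \<in> I \<and> d \<noteq> 0" using I_y by blast
  then obtain d where d: "d \<in> I" "d \<noteq> 0" "\<And>p. p \<in> I \<Longrightarrow> p \<noteq> 0 \<Longrightarrow> degree d \<le> degree p"
    using ex_has_least_nat[of "\<lambda>d. d \<in> I \<and> d \<noteq> 0" _ degree] by blast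
  have "d dvd y i" for i
  proof -
    have "y i mod d = y i - (y i div d) * d" by (simp add: minus_div_mult_eq_mod)
    then have "y i mod d \<in> I" using I_diff I_y d(1) by simp
    then have "y i mod d = 0" using d(2,3) degree_mod_less[of d "y i"] by force
    then show ?thesis by (rule mod_0_imp_dvd)
  qed
  then have "is_unit d" using assms unfolding poly_family_coprime_def by blast
  then obtain e where e: "1 = d * e" by (elim dvdE)
  obtain w where "d = (\<Sum>i\<in>UNIV. w i * y i)" using d(1) unfolding I_def by blast
  then have "(\<Sum>i\<in>UNIV. (e * w i) * y i) = 1"
    by (simp add: e sum_distrib_left sum_distrib_right ac_simps)
  then show ?thesis by (rule exI[of _ "\<lambda>i. e * w i"])
qed

text \<open>Multiplying a Bezout relation for \<open>y'\<close> by \<open>g'\<close> shows that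
  \<open>g\<close> divides \<open>g'\<close>. By symmetry they are associated, and both are
  monic.\<close>

lemma monic_content_unique:
  fixes y y' :: "'n::finite \<Rightarrow> 'a::field poly"
  assumes "poly_family_coprime y" "poly_family_coprime y'" "\<And>i. g * y i = g' * y' i"
    and "lead_coeff g = 1" "lead_coeff g' = 1"
  shows "g = g'"
proof -
  have "a dvd b" if z: "poly_family_coprime z'" "\<And>i. a * z i = b * z' i" for a b and z z' :: "'n \<Rightarrow> 'a poly"
  proof -
    obtain u where u: "(\<Sum>i\<in>UNIV. u i * z' i) = 1" using poly_family_bezout[OF z(1)] by blast
    have "b = b * (\<Sum>i\<in>UNIV. u i * z' i)" by (simp add: u)
    also have "\<dots> = (\<Sum>i\<in>UNIV. u i * (b * z' i))"
      unfolding sum_distrib_left by (rule sum.cong[OF refl]) (rule mult.left_commute)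
    also have "\<dots> = a * (\<Sum>i\<in>UNIV. u i * z i)"
      unfolding z(2)[symmetric] sum_distrib_left by (rule sum.cong[OF refl]) (rule mult.left_commute)
    finally show ?thesis by (rule dvdI)
  qed
  from this[of y' g y g'] this[of y g' y' g] assms have "g dvd g'" "g' dvd g" by auto
  then obtain k where k: "g' = g * k" by (elim dvdE)
  have nz: "g \<noteq> 0" "k \<noteq> 0" using assms(4,5) k by auto
  have "degree g' \<le> degree g" using \<open>g' dvd g\<close> nz by (intro dvd_imp_degree_le)
  then have "degree k = 0" using nz by (simp add: k degree_mult_eq)
  then obtain c where "k = [:c:]" by (rule degree_eq_zeroE)
  moreover have "lead_coeff k = 1" using assms(4,5) by (simp add: k lead_coeff_mult)
  ultimately show ?thesis using k by simp
qed

lemma max_degree_le_iff: "max_degree x \<le> P \<longleftrightarrow> x \<in> poly_vecs P"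
  by (auto simp: max_degree_def poly_vecs_def)

lemma max_degree_attained: "\<exists>i. degree (x i) = max_degree x"
proof -
  have "Max (range (\<lambda>i. degree (x i))) \<in> range (\<lambda>i. degree (x i))" by (rule Max_in) auto
  then show ?thesis unfolding max_degree_def by (metis imageE)
qed

lemma max_degree_mult:
  fixes y :: "'n::finite \<Rightarrow> 'a::field poly"
  assumes "g \<noteq> 0" "y i \<noteq> 0"
  shows "max_degree (\<lambda>i. g * y i) = degree g + max_degree y"
proof (rule antisym)
  have "degree (y j) \<le> max_degree y" for j
    using max_degree_le_iff[of y "max_degree y"] by (simp add: poly_vecs_def)
  then show "max_degree (\<lambda>i. g * y i) \<le> degree g + max_degree y"
    unfolding max_degree_le_iff poly_vecs_def
    by (auto intro!: order.trans[OF degree_mult_le])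
  obtain j where "degree (y j) = max_degree y" using max_degree_attained by blast
  \<comment> \<open>A zero component has degree 0, so if the maximum is attained there it equals 0,
    and the nonzero component \<open>y i\<close> attains it as well.\<close>
  then obtain k where k: "degree (y k) = max_degree y" "y k \<noteq> 0"
    using assms(2) \<open>\<And>j. degree (y j) \<le> max_degree y\<close>[of i] by (cases "y j = 0") auto
  then have "degree g + max_degree y = degree (g * y k)" using assms(1) by (simp add: degree_mult_eq)
  also have "\<dots> \<le> max_degree (\<lambda>i. g * y i)"
    using max_degree_le_iff[of "\<lambda>i. g * y i" "max_degree (\<lambda>i. g * y i)"] by (simp add: poly_vecs_def)
  finally show "degree g + max_degree y \<le> max_degree (\<lambda>i. g * y i)" .
qed

lemma qf_eval_mult: "qf_eval A (\<lambda>i. g * y i) = g ^ 2 * qf_eval A y"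
  unfolding qf_eval_def sum_distrib_left
  by (intro sum.cong refl) (simp only: power2_eq_square mult_ac)

text \<open>Take a common divisor of greatest degree and make it monic. A nonconstant common divisor
  of the quotients would produce a common divisor of larger degree.\<close>

lemma exists_monic_content:
  fixes x :: "'n::finite \<Rightarrow> 'a::field poly"
  assumes "x i \<noteq> 0"
  shows "\<exists>g y. lead_coeff g = 1 \<and> poly_family_coprime y \<and> x = (\<lambda>i. g * y i)"
proof -
  let ?D = "\<lambda>g. \<forall>j. g dvd x j"
  have nz: "g \<noteq> 0" if "?D g" for g using that assms by auto
  have bound: "degree h < Suc (degree (x i))" if "?D h" for h
    using dvd_imp_degree_le[of h "x i"] that assms by (simp add: less_Suc_eq_le)
  have "\<exists>g. ?D g \<and> (\<forall>h. ?D h \<longrightarrow> degree h \<le> degree g)"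
    by (rule ex_has_greatest_nat[of _ 1 _ "Suc (degree (x i))"], simp) (use bound in blast)
  then obtain g0 where g0: "?D g0" "\<And>h. ?D h \<Longrightarrow> degree h \<le> degree g0" by blast
  define g where "g = smult (inverse (lead_coeff g0)) g0"
  have lead: "lead_coeff g = 1" using nz[OF g0(1)] by (simp add: g_def)
  have g: "?D g" "degree g = degree g0"
    using g0(1) nz[OF g0(1)] by (auto simp: g_def smult_dvd)
  define y where "y j = x j div g" for j
  have x: "x j = g * y j" for j using g(1) by (simp add: y_def)
  have "is_unit c" if c: "\<And>j. c dvd y j" for c
  proof -
    have D: "?D (g * c)" using c by (simp add: x mult_dvd_mono)
    then have "degree (g * c) \<le> degree g" using g0(2) g(2) by simp
    moreover have "degree (g * c) = degree g + degree c"
      using nz[OF D] by (intro degree_mult_eq) auto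
    ultimately show ?thesis using nz[OF D] by (simp add: is_unit_iff_degree)
  qed
  then have "poly_family_coprime y" by (auto simp: poly_family_coprime_def)
  with lead x show ?thesis by blast
qed

lemma card_monic:
  "card {g :: 'a::{finite,field} poly. degree g = k \<and> lead_coeff g = 1} = CARD('a) ^ k"
proof (cases k)
  case 0
  have "{g :: 'a poly. degree g = k \<and> lead_coeff g = 1} = {1}"
    unfolding 0 by (auto elim: degree_eq_zeroE)
  then show ?thesis using 0 by simp
next
  case (Suc m)
  have "bij_betw (\<lambda>p. p + monom 1 k) (polys_upto m) {g :: 'a poly. degree g = k \<and> lead_coeff g = 1}"
  proof (rule bij_betw_byWitness[where f' = "\<lambda>p. p - monom 1 k"])
    show "(\<lambda>p. p + monom 1 k) ` polys_upto m \<subseteq> {g :: 'a poly. degree g = k \<and> lead_coeff g = 1}"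
    proof clarify
      fix p :: "'a poly" assume "p \<in> polys_upto m"
      then have p: "degree p < k" by (simp add: polys_upto_def Suc)
      then have "degree (p + monom 1 k) = k" by (simp add: degree_add_eq_right degree_monom_eq)
      then show "degree (p + monom 1 k) = k \<and> lead_coeff (p + monom 1 k) = 1"
        using p by (simp add: coeff_eq_0)
    qed
    show "(\<lambda>p. p - monom 1 k) ` {g :: 'a poly. degree g = k \<and> lead_coeff g = 1} \<subseteq> polys_upto m"
    proof clarify
      fix g :: "'a poly" assume g: "lead_coeff g = 1" "k = degree g"
      have "degree (g - monom 1 (degree g)) \<le> m"
      proof (rule degree_le, clarify)
        fix i assume "m < i"
        then consider "i = degree g" | "i > degree g" using g Suc by linarith
        then show "coeff (g - monom 1 (degree g)) i = 0" by cases (use g in \<open>auto simp: coeff_eq_0\<close>)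
      qed
      then show "g - monom 1 (degree g) \<in> polys_upto m" by (simp add: polys_upto_def)
    qed
  qed auto
  from bij_betw_same_card[OF this] show ?thesis by (simp add: card_polys_upto Suc)
qed

section \<open>From all zeros to primitive zeros\<close>

definition primitive_zeros :: "'a::{finite,field} ^ 'n::finite ^ 'n \<Rightarrow> nat \<Rightarrow> ('n \<Rightarrow> 'a poly) set" where
  "primitive_zeros A d = {x. poly_family_coprime x \<and> max_degree x = d \<and> qf_eval A x = 0}"

text \<open>The zero vector is excluded: \<open>max_degree\<close> would place it in degree 0, but
  it is no monic multiple of a primitive vector.\<close>

definition zeros_of_degree :: "'a::{finite,field} ^ 'n::finite ^ 'n \<Rightarrow> nat \<Rightarrow> ('n \<Rightarrow> 'a poly) set" where
  "zeros_of_degree A d = {x. x \<noteq> (\<lambda>_. 0) \<and> max_degree x = d \<and> qf_eval A x = 0}"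

lemma poly_family_coprime_nonzero: "poly_family_coprime y \<Longrightarrow> \<exists>i. y i \<noteq> (0 :: 'a::field poly)"
  unfolding poly_family_coprime_def by (metis dvd_0_right not_is_unit_0)

lemma finite_primitive_zeros [simp]: "finite (primitive_zeros A d)"
proof (rule finite_subset)
  show "primitive_zeros A d \<subseteq> poly_vecs d"
    by (auto simp: primitive_zeros_def simp flip: max_degree_le_iff)
qed simp

lemma card_zeros_of_degree:
  fixes A :: "'a::{finite,field} ^ 'n::finite ^ 'n"
  shows "card (zeros_of_degree A d) = (\<Sum>k\<le>d. CARD('a) ^ k * card (primitive_zeros A (d - k)))"
proof -
  let ?M = "\<lambda>k. {g :: 'a poly. degree g = k \<and> lead_coeff g = 1}"
  let ?U = "SIGMA k:{..d}. ?M k \<times> primitive_zeros A (d - k)"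
  define F where "F = (\<lambda>(k :: nat, g :: 'a poly, y :: 'n \<Rightarrow> 'a poly). (\<lambda>i. g * y i))"
  have nz: "g \<noteq> 0" if "g \<in> ?M k" for g k using that by auto
  have finM: "finite (?M k)" for k using card_monic[where 'a = 'a, of k] by (simp add: card_ge_0_finite)
  have "inj_on F ?U"
  proof (rule inj_onI)
    fix a b assume ab: "a \<in> ?U" "b \<in> ?U" "F a = F b"
    obtain k g y k' g' y' where kg: "a = (k, g, y)" "b = (k', g', y')" by (metis prod_cases3)
    have *: "F (k, g, y) = F (k', g', y')" "k = degree g" "k' = degree g'" "lead_coeff g = 1" "lead_coeff g' = 1"
      "y \<in> primitive_zeros A (d - degree g)" "y' \<in> primitive_zeros A (d - degree g')"
      using ab by (auto simp: kg)
    have eq: "g * y i = g' * y' i" for i using fun_cong[OF *(1), of i] by (simp add: F_def)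
    have "poly_family_coprime y" "poly_family_coprime y'" using *(6,7) by (auto simp: primitive_zeros_def)
    then have "g = g'" using eq *(4,5) by (rule monic_content_unique)
    moreover have "y = y'"
    proof
      fix i
      show "y i = y' i" using eq[of i] \<open>g = g'\<close> *(4) by auto
    qed
    ultimately show "a = b" using *(2,3) by (simp add: kg)
  qed
  moreover have "F ` ?U = zeros_of_degree A d"
  proof
    show "F ` ?U \<subseteq> zeros_of_degree A d"
    proof (rule image_subsetI)
      fix a assume a: "a \<in> ?U"
      obtain k g y where kg: "a = (k, g, y)" by (rule prod_cases3)
      have *: "degree g \<le> d" "lead_coeff g = 1" "y \<in> primitive_zeros A (d - degree g)" and k: "k = degree g"
        using a by (auto simp: kg)
      then obtain i where i: "y i \<noteq> 0" using poly_family_coprime_nonzero by (auto simp: primitive_zeros_def)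
      have g: "g \<noteq> 0" using *(2) by auto
      have "max_degree (\<lambda>i. g * y i) = d"
        using max_degree_mult[of g y i] g i * by (simp add: primitive_zeros_def)
      moreover have "(\<lambda>i. g * y i) \<noteq> (\<lambda>_. 0)" using g i by (metis mult_eq_0_iff)
      ultimately show "F a \<in> zeros_of_degree A d"
        using * by (simp add: kg k F_def zeros_of_degree_def primitive_zeros_def qf_eval_mult)
    qed
    show "zeros_of_degree A d \<subseteq> F ` ?U"
    proof
      fix x assume x: "x \<in> zeros_of_degree A d"
      then obtain i where "x i \<noteq> 0" by (auto simp: zeros_of_degree_def)
      then obtain g y where gy: "lead_coeff g = 1" "poly_family_coprime y" "x = (\<lambda>i. g * y i)"
        using exists_monic_content by blast
      obtain j where j: "y j \<noteq> 0" using poly_family_coprime_nonzero[OF gy(2)] by blast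
      have g: "g \<noteq> 0" using gy(1) by auto
      have d: "degree g + max_degree y = d"
        using max_degree_mult[of g y j] g j x gy(3) by (simp add: zeros_of_degree_def)
      moreover have "qf_eval A y = 0" using x g by (simp add: zeros_of_degree_def gy(3) qf_eval_mult)
      ultimately have "(degree g, g, y) \<in> ?U" using gy by (auto simp: primitive_zeros_def)
      moreover have "x = F (degree g, g, y)" by (simp add: F_def gy(3))
      ultimately show "x \<in> F ` ?U" by (rule rev_image_eqI)
    qed
  qed
  ultimately have "card (zeros_of_degree A d) = card ?U" by (simp flip: card_image)
  also have "\<dots> = (\<Sum>k\<le>d. card (?M k \<times> primitive_zeros A (d - k)))"
    using finM by (intro card_SigmaI) auto
  finally show ?thesis by (simp add: card_cartesian_product card_monic)
qed

text \<open>The weights \<open>q ^ k\<close> are geometric, so passing from \<open>d\<close> to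
  \<open>Suc d\<close> multiplies the old sum by \<open>q\<close> and adds the term
  \<open>k = 0\<close>. In generating series, this is multiplication by
  \<open>1 - q T\<close>.\<close>

lemma card_zeros_of_degree_Suc:
  fixes A :: "'a::{finite,field} ^ 'n::finite ^ 'n"
  shows "card (zeros_of_degree A (Suc d))
    = card (primitive_zeros A (Suc d)) + CARD('a) * card (zeros_of_degree A d)"
  unfolding card_zeros_of_degree sum.atMost_Suc_shift
  by (simp add: sum_distrib_left mult.assoc)

text \<open>The summand 1 is the zero vector; it is the source of the convention
  \<open>M(-1) = 1\<close>.\<close>

lemma card_poly_vec_zeros_split:
  fixes A :: "'a::{finite,field} ^ 'n::finite ^ 'n"
  shows "card {x \<in> poly_vecs 0. qf_eval A x = 0} = 1 + card (zeros_of_degree A 0)"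
    and "card {x \<in> poly_vecs (Suc d). qf_eval A x = 0}
      = card {x \<in> poly_vecs d. qf_eval A x = 0} + card (zeros_of_degree A (Suc d))"
proof -
  have fin: "finite {x \<in> poly_vecs P. qf_eval A x = 0}" for P by simp
  have zero: "qf_eval A (\<lambda>_. 0) = 0" "max_degree (\<lambda>_ :: 'n. 0 :: 'a poly) = 0"
    by (auto simp: qf_eval_def max_degree_def)
  have e: "{x \<in> poly_vecs 0. qf_eval A x = 0} = insert (\<lambda>_. 0) (zeros_of_degree A 0)"
    using zero by (auto simp: zeros_of_degree_def simp flip: max_degree_le_iff)
  show "card {x \<in> poly_vecs 0. qf_eval A x = 0} = 1 + card (zeros_of_degree A 0)"
    using fin[of 0] unfolding e by (simp add: zeros_of_degree_def)
  have e': "{x \<in> poly_vecs (Suc d). qf_eval A x = 0}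
      = {x \<in> poly_vecs d. qf_eval A x = 0} \<union> zeros_of_degree A (Suc d)"
    using zero by (auto simp: zeros_of_degree_def le_Suc_eq simp flip: max_degree_le_iff)
  show "card {x \<in> poly_vecs (Suc d). qf_eval A x = 0}
      = card {x \<in> poly_vecs d. qf_eval A x = 0} + card (zeros_of_degree A (Suc d))"
    using fin[of "Suc d"] unfolding e'
    by (intro card_Un_disjoint) (auto simp: zeros_of_degree_def simp flip: max_degree_le_iff)
qed

section \<open>Closed forms\<close>

text \<open>For \<open>u\<close> the positive number with \<open>s = - u\<close> and
  \<open>Q = u ^ 2\<close>, the contributions of successive ranks form a geometric progression with
  ratio \<open>- q ^ 2 / u\<close>. The factor \<open>u + q ^ 2\<close> clears its
  denominator.\<close>

lemma geometric_rank_sum: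
  fixes u q :: real
  shows "(u + q ^ 2) * (\<Sum>k<P. (u ^ 2) ^ (P - k) * (- u) ^ Suc k * (q ^ (2 * Suc k) - q ^ (2 * k)))
    = - (u ^ 2) * (q ^ 2 - 1) * ((u ^ 2) ^ P - (- u * q ^ 2) ^ P)"
proof (induction P)
  case (Suc P)
  have "(\<Sum>k<Suc P. (u ^ 2) ^ (Suc P - k) * (- u) ^ Suc k * (q ^ (2 * Suc k) - q ^ (2 * k)))
      = u ^ 2 * (\<Sum>k<P. (u ^ 2) ^ (P - k) * (- u) ^ Suc k * (q ^ (2 * Suc k) - q ^ (2 * k)))
        + u ^ 2 * ((- u) ^ Suc P * (q ^ (2 * Suc P) - q ^ (2 * P)))"
    by (simp add: sum_distrib_left Suc_diff_le mult.assoc)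
  also have "(u + q ^ 2) * \<dots> = u ^ 2 * (- (u ^ 2) * (q ^ 2 - 1) * ((u ^ 2) ^ P - (- u * q ^ 2) ^ P))
      + (u + q ^ 2) * (u ^ 2 * ((- u) ^ Suc P * (q ^ (2 * Suc P) - q ^ (2 * P))))"
    unfolding distrib_left[of "u + q ^ 2"] mult.left_commute[of "u + q ^ 2" "u ^ 2"] Suc.IH ..
  also have "(- u) ^ Suc P * (q ^ (2 * Suc P) - q ^ (2 * P)) = - u * (q ^ 2 - 1) * (- u * q ^ 2) ^ P"
    by (simp only: power_mult_distrib power_mult[symmetric]) (simp add: algebra_simps power2_eq_square)
  finally show ?case by (simp add: algebra_simps power2_eq_square)
qed simp

text \<open>After division by \<open>q ^ (2 * P)\<close> two geometric sequences remain. The one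
  with ratio \<open>u ^ 2 / q ^ 2\<close> compares the number of coefficients with the number of
  equations, and the one with ratio \<open>- u\<close> carries the sign of the discriminant.\<close>

lemma card_poly_zeros_closed_form:
  fixes A :: "'a::{finite,field} ^ 'n::finite ^ 'n"
  assumes odd: "odd CARD('a)" and n: "CARD('n) = 2 * m" and base: "balanced UNIV (\<lambda>w. bil A w w) (- u)"
  defines "q \<equiv> real CARD('a)"
  assumes u: "u = q ^ m"
  shows "(u + q ^ 2) * q * real (card {x \<in> poly_vecs P. qf_eval A x = 0})
    = u ^ 2 * (u + 1) * (u ^ 2 / q ^ 2) ^ P + u * q * (q - 1) * (u - q) * (- u) ^ P"
proof -
  let ?M = "real (card {x \<in> poly_vecs P. qf_eval A x = 0})"
  have q: "q > 0" by (simp add: q_def)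
  have Q: "real CARD('a ^ 'n) = u ^ 2" by (simp add: n u q_def power_mult[symmetric] mult.commute)
  have "q ^ Suc (2 * P) * ?M
    = (u ^ 2) ^ Suc P + (\<Sum>k<P. (u ^ 2) ^ (P - k) * (- u) ^ Suc k * (q ^ (2 * Suc k) - q ^ (2 * k)))
      + (- u) ^ Suc P * (q ^ Suc (2 * P) - q ^ (2 * P))"
    using card_poly_zeros[OF odd base, of P] unfolding Q q_def[symmetric] .
  then have "(u + q ^ 2) * (q ^ Suc (2 * P) * ?M) = (u + q ^ 2) * (u ^ 2) ^ Suc P
      + - (u ^ 2) * (q ^ 2 - 1) * ((u ^ 2) ^ P - (- u * q ^ 2) ^ P)
      + (u + q ^ 2) * ((- u) ^ Suc P * (q ^ Suc (2 * P) - q ^ (2 * P)))"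
    by (simp only: distrib_left geometric_rank_sum)
  also have "(- u) ^ Suc P * (q ^ Suc (2 * P) - q ^ (2 * P)) = - u * (q - 1) * (- u * q ^ 2) ^ P"
    by (simp only: power_mult_distrib power_mult[symmetric]) (simp add: algebra_simps)
  also have "(u + q ^ 2) * (u ^ 2) ^ Suc P
      + - (u ^ 2) * (q ^ 2 - 1) * ((u ^ 2) ^ P - (- u * q ^ 2) ^ P)
      + (u + q ^ 2) * (- u * (q - 1) * (- u * q ^ 2) ^ P)
    = u ^ 2 * (u + 1) * (u ^ 2) ^ P + u * q * (q - 1) * (u - q) * (- u * q ^ 2) ^ P"
    by (simp add: algebra_simps power2_eq_square)
  also have "(u ^ 2) ^ P = (u ^ 2 / q ^ 2) ^ P * q ^ (2 * P)"
    using q by (simp add: power_divide power_mult)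
  also have "(- u * q ^ 2) ^ P = (- u) ^ P * q ^ (2 * P)" by (simp only: power_mult_distrib power_mult[symmetric])
  finally have "q ^ (2 * P) * ((u + q ^ 2) * q * ?M) = q ^ (2 * P) * (u ^ 2 * (u + 1) * (u ^ 2 / q ^ 2) ^ P
      + u * q * (q - 1) * (u - q) * (- u) ^ P)"
    by (simp add: algebra_simps)
  then show ?thesis using q by simp
qed

text \<open>The second difference with roots 1 and \<open>q\<close> multiplies a sequence of ratio
  \<open>x\<close> by \<open>(x - 1) * (x - q) / x ^ 2\<close>. For \<open>x = u ^ 2 / q ^ 2\<close>
  this gives the factors \<open>u ^ 2 - q ^ 2\<close> and \<open>u ^ 2 - q ^ 3\<close>; for
  \<open>x = - u\<close> it gives \<open>(u + 1) * (u + q)\<close>, and \<open>u + q\<close>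
  combines with the factor \<open>u - q\<close> already present.\<close>

lemma card_primitive_zeros_closed_form:
  fixes A :: "'a::{finite,field} ^ 'n::finite ^ 'n"
  assumes odd: "odd CARD('a)" and n: "CARD('n) = 2 * m" and base: "balanced UNIV (\<lambda>w. bil A w w) (- u)"
  defines "q \<equiv> real CARD('a)"
  assumes u: "u = q ^ m" and P: "P \<ge> 1"
  shows "(u + q ^ 2) * q * u ^ 2 * real (card (primitive_zeros A P))
    = (u + 1) * (u ^ 2 - q ^ 2) * (u ^ 2 - q ^ 3) * (u ^ 2 / q ^ 2) ^ P
      + u * q * (q - 1) * (u + 1) * (u ^ 2 - q ^ 2) * (- u) ^ P"
proof -
  define N where "N d = real (card {x \<in> poly_vecs d. qf_eval A x = 0})" for d
  define E where "E d = real (card (zeros_of_degree A d))" for d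
  have q: "q > 0" by (simp add: q_def)
  have upos: "u > 0" using q by (simp add: u)
  have N: "(u + q ^ 2) * q * N d
      = u ^ 2 * (u + 1) * (u ^ 2 / q ^ 2) ^ d + u * q * (q - 1) * (u - q) * (- u) ^ d" for d
    unfolding N_def q_def by (rule card_poly_zeros_closed_form[OF odd n base]) (use u in \<open>simp add: q_def\<close>)
  have E0: "E 0 = N 0 - 1" and ES: "E (Suc d) = N (Suc d) - N d" for d
    unfolding E_def N_def card_poly_vec_zeros_split by simp_all
  obtain p where p: "P = Suc p" using P by (cases P) auto
  have prim: "real (card (primitive_zeros A P)) = E (Suc p) - q * E p"
    using card_zeros_of_degree_Suc[of A p] by (simp add: E_def q_def p)
  define X where "X = u ^ 2 / q ^ 2"
  have X: "u ^ 2 = X * q ^ 2" using q by (simp add: X_def)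
  show ?thesis
  proof (cases p)
    \<comment> \<open>The third term is now the zero vector alone. The closed form of
      \<open>N\<close>, extended to \<open>d = -1\<close>, takes exactly the value 1, which is why
      the general formula persists for \<open>P = 1\<close>.\<close>
    case 0
    have "(u + q ^ 2) * q * u ^ 2 * real (card (primitive_zeros A P))
        = u ^ 2 * ((u + q ^ 2) * q * N 1 - (1 + q) * ((u + q ^ 2) * q * N 0) + q * ((u + q ^ 2) * q))"
      by (simp add: prim 0 ES E0 algebra_simps)
    also have "\<dots> = (u + 1) * (u ^ 2 - q ^ 2) * (u ^ 2 - q ^ 3) * X ^ P
      + u * q * (q - 1) * (u + 1) * (u ^ 2 - q ^ 2) * (- u) ^ P"
      unfolding N X_def[symmetric] p 0 by (simp add: X_def) (use q in \<open>simp add: field_simps power2_eq_square power3_eq_cube\<close>)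
    finally show ?thesis by (simp add: X_def)
  next
    case (Suc r)
    have "(u + q ^ 2) * q * u ^ 2 * real (card (primitive_zeros A P))
        = u ^ 2 * ((u + q ^ 2) * q * N (Suc (Suc r)) - (1 + q) * ((u + q ^ 2) * q * N (Suc r))
          + q * ((u + q ^ 2) * q * N r))"
      by (simp add: prim Suc ES algebra_simps)
    also have "\<dots> = u ^ 2 * (u + 1) * (u ^ 2 * X ^ 2 - (1 + q) * u ^ 2 * X + q * u ^ 2) * X ^ r
        + u * q * (q - 1) * (u - q) * (u ^ 2 * (u + 1) * (u + q)) * (- u) ^ r"
      unfolding N X_def[symmetric] by (simp add: algebra_simps power2_eq_square)
    also have "u ^ 2 * (u + 1) * (u ^ 2 * X ^ 2 - (1 + q) * u ^ 2 * X + q * u ^ 2)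
        = (u + 1) * (u ^ 2 - q ^ 2) * (u ^ 2 - q ^ 3) * X ^ 2"
      unfolding X by (simp add: algebra_simps power2_eq_square power3_eq_cube)
    also have "u * q * (q - 1) * (u - q) * (u ^ 2 * (u + 1) * (u + q)) * (- u) ^ r
        = u * q * (q - 1) * (u + 1) * (u ^ 2 - q ^ 2) * (- u) ^ P"
      by (simp add: p Suc algebra_simps power2_eq_square)
    finally show ?thesis by (simp add: p Suc X_def power2_eq_square mult.assoc)
  qed
qed

theorem theorem1p2:
  fixes A :: "'a::{finite,field} ^'n::finite ^'n" and P :: nat
  defines "q \<equiv> real CARD('a)" and "n \<equiv> CARD('n)"
  assumes odd_q: "odd (CARD('a))"
    and n_even: "even n" and n_ge: "n \<ge> 4"
    and symm: "transpose A = A"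
    and nondeg: "det A \<noteq> 0"
    and nonsq: "\<not> (\<exists>y::'a. y ^ 2 = (-1) ^ (n div 2) * det A)"
    and P_ge: "P \<ge> 1"
  shows "(n = 4 \<longrightarrow> num_mor A P =
            (if even P then (q ^ 4 - 1) / q ^ 2 * q ^ (2 * P) else 0))
       \<and> (n \<ge> 6 \<longrightarrow> num_mor A P =
            (q ^ (n div 2) + 1) * (q ^ (n - 2) - 1) * (q ^ (n - 3) - 1)
              / (q ^ (n - 2) * (q ^ (n div 2 - 2) + 1) * (q - 1)) * q ^ (P * (n - 2))
            + (-1) ^ P * ((q ^ (n - 2) - 1) * (q ^ (n div 2) + 1)
              / (q ^ (n div 2) * (q ^ (n div 2 - 2) + 1))) * q ^ (n div 2 * P))"
proof -
  obtain m where m: "n = 2 * m" using n_even by (elim evenE)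
  have m2: "m \<ge> 2" "n div 2 = m" using n_ge m by simp_all
  define u where "u = q ^ m"
  have q1: "q > 1" using CARD_field_gt_1[where 'a = 'a] by (simp add: q_def)
  then have upos: "u > 0" by (simp add: u_def)
  have "quad_char ((-1) ^ (CARD('n) div 2) * det A) = -1"
    using nonsq by (simp add: quad_char_def n_def)
  then have base: "balanced UNIV (\<lambda>w. bil A w w) (- u)"
    using balanced_bil[OF odd_q _ symm nondeg] n_even m2(2) by (simp add: n_def u_def q_def)
  define x where "x = real (card (primitive_zeros A P))"
  have x: "(u + q ^ 2) * q * u ^ 2 * x = (u + 1) * (u ^ 2 - q ^ 2) * (u ^ 2 - q ^ 3) * (u ^ 2 / q ^ 2) ^ P
      + u * q * (q - 1) * (u + 1) * (u ^ 2 - q ^ 2) * (- u) ^ P"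
    unfolding x_def q_def
    by (rule card_primitive_zeros_closed_form[OF odd_q _ base]) (use m u_def P_ge in \<open>auto simp: n_def q_def\<close>)
  have num: "num_mor A P = x / (q - 1)"
    by (simp add: num_mor_def x_def primitive_zeros_def q_def)
  have pows: "q ^ (n - 2) = u ^ 2 / q ^ 2" "q ^ (n - 3) = u ^ 2 / q ^ 3" "q ^ (m - 2) = u / q ^ 2"
    using q1 m2(1) by (simp_all add: u_def m power_diff power_mult[symmetric] mult.commute)
  have "num_mor A P = (u + 1) * (u ^ 2 / q ^ 2 - 1) * (u ^ 2 / q ^ 3 - 1)
          / (u ^ 2 / q ^ 2 * (u / q ^ 2 + 1) * (q - 1)) * (u ^ 2 / q ^ 2) ^ P
        + (u ^ 2 / q ^ 2 - 1) * (u + 1) / (u * (u / q ^ 2 + 1)) * (- u) ^ P"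
  proof -
    define v where "v = u + q ^ 2"
    have v: "v > 0" using upos by (simp add: v_def add_pos_nonneg)
    have fr: "u ^ 2 / q ^ 2 - 1 = (u ^ 2 - q ^ 2) / q ^ 2" "u ^ 2 / q ^ 3 - 1 = (u ^ 2 - q ^ 3) / q ^ 3"
      "u / q ^ 2 + 1 = v / q ^ 2"
      using q1 by (simp_all add: v_def diff_divide_distrib add_divide_distrib)
    have "x = ((u + 1) * (u ^ 2 - q ^ 2) * (u ^ 2 - q ^ 3) * (u ^ 2 / q ^ 2) ^ P
        + u * q * (q - 1) * (u + 1) * (u ^ 2 - q ^ 2) * (- u) ^ P) / (v * q * u ^ 2)"
      using x v q1 upos by (simp add: v_def nonzero_eq_divide_eq mult.commute)
    then have "x / (q - 1) = (u + 1) * (u ^ 2 - q ^ 2) * (u ^ 2 - q ^ 3) / (v * q * u ^ 2 * (q - 1)) * (u ^ 2 / q ^ 2) ^ P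
        + u * q * (q - 1) * (u + 1) * (u ^ 2 - q ^ 2) / (v * q * u ^ 2 * (q - 1)) * (- u) ^ P"
      by (simp add: add_divide_distrib)
    also have "(u + 1) * (u ^ 2 - q ^ 2) * (u ^ 2 - q ^ 3) / (v * q * u ^ 2 * (q - 1))
        = (u + 1) * ((u ^ 2 - q ^ 2) / q ^ 2) * ((u ^ 2 - q ^ 3) / q ^ 3) / (u ^ 2 / q ^ 2 * (v / q ^ 2) * (q - 1))"
      using q1 v upos by (simp add: divide_simps) (simp add: power2_eq_square power3_eq_cube flip: power_Suc2)
    also have "u * q * (q - 1) * (u + 1) * (u ^ 2 - q ^ 2) / (v * q * u ^ 2 * (q - 1))
        = ((u ^ 2 - q ^ 2) / q ^ 2) * (u + 1) / (u * (v / q ^ 2))"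
      using q1 v upos by (simp add: divide_simps power2_eq_square)
    finally show ?thesis unfolding num fr .
  qed
  also have "(- u) ^ P = (-1) ^ P * q ^ (m * P)"
    by (simp add: u_def power_minus[of "q ^ m"] power_mult)
  also have "(u ^ 2 / q ^ 2) ^ P = q ^ (P * (n - 2))"
    unfolding pows(1)[symmetric] by (simp add: power_mult[symmetric] mult.commute)
  finally have main: "num_mor A P = (q ^ m + 1) * (q ^ (n - 2) - 1) * (q ^ (n - 3) - 1)
              / (q ^ (n - 2) * (q ^ (m - 2) + 1) * (q - 1)) * q ^ (P * (n - 2))
            + (-1) ^ P * ((q ^ (n - 2) - 1) * (q ^ m + 1)
              / (q ^ m * (q ^ (m - 2) + 1))) * q ^ (m * P)"
    by (simp add: pows u_def mult_ac)
  \<comment> \<open>For \<open>n = 4\<close> one has \<open>u = q ^ 2\<close>, so the two ratios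
    \<open>u ^ 2 / q ^ 2\<close> and \<open>- u\<close> differ only in sign, and the two
    coefficients coincide. What remains is the factor \<open>1 + (-1) ^ P\<close>; the 2 in the
    denominator is \<open>q ^ (m - 2) + 1\<close> at \<open>m = 2\<close>.\<close>
  have "num_mor A P = (if even P then (q ^ 4 - 1) / q ^ 2 * q ^ (2 * P) else 0)" if "n = 4"
  proof -
    have "m = 2" using that m by simp
    then have *: "num_mor A P = (q ^ 2 + 1) * (q ^ 2 - 1) * (q - 1) / (q ^ 2 * 2 * (q - 1)) * q ^ (2 * P)
        + (-1) ^ P * ((q ^ 2 - 1) * (q ^ 2 + 1) / (q ^ 2 * 2)) * q ^ (2 * P)"
      using main that by (simp add: mult.commute[of P])
    also have "\<dots> = (q ^ 2 + 1) * (q ^ 2 - 1) / (q ^ 2 * 2) * q ^ (2 * P) * (1 + (-1) ^ P)"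
      using q1 by (simp add: field_simps)
    also have "(q ^ 2 + 1) * (q ^ 2 - 1) = q ^ 4 - 1" by (simp add: algebra_simps power2_eq_square power4_eq_xxxx)
    finally show ?thesis by (cases "even P") auto
  qed
  with main m2 show ?thesis by simp
qed

end
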